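(* Let $\Omega\subset\mathbb{C}$ be a hyperbolic domain (i.e. $\mathbb{C}\setminus\Omega$ contains at least two points), and for $w_1,w_2\in\Omega$ let $\eta_\Omega(w_1,w_2)=\inf_\gamma\int_\gamma \eta_\Omega(w)\,|dw|$ be the Hurwitz distance, the infimum being over all rectifiable paths $\gamma$ in $\Omega$ joining $w_1$ and $w_2$. Then $(\Omega,\eta_\Omega)$ is a complete metric space.
   Context: A domain is a nonempty connected open subset of $\mathbb{C}$; $\mathbb{D}=\{w\in\mathbb{C}:|w|<1\}$. For a proper subdomain $\Omega\subsetneq\mathbb{C}$ and $w\in\Omega$, let $\mathcal{H}(w,\Omega)$ be the family of holomorphic functions $h:\mathbb{D}\to\Omega$ with $h(0)=w$, $h(t)\neq w$ for all $t\in\mathbb{D}\setminus\{0\}$, and $h'(0)>0$. The Hurwitz density of $\Omega$ is $\eta_\Omega(w)=2/r_\Omega(w)$, where $r_\Omega(w)=\max\{h'(0):h\in\mathcal{H}(w,\Omega)\}$. *)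

theory Defs
  imports "HOL-Analysis.Analysis"
begin

definition hurwitz_family :: "complex \<Rightarrow> complex set \<Rightarrow> (complex \<Rightarrow> complex) set" where
  "hurwitz_family w \<Omega> = {h. h holomorphic_on ball 0 1 \<and> h ` ball 0 1 \<subseteq> \<Omega> \<and> h 0 = w \<and>
     (\<forall>t\<in>ball 0 1 - {0}. h t \<noteq> w) \<and> deriv h 0 \<in> \<real> \<and> Re (deriv h 0) > 0}"

definition hurwitz_radius :: "complex set \<Rightarrow> complex \<Rightarrow> real" where
  "hurwitz_radius \<Omega> w = (GREATEST r. \<exists>h\<in>hurwitz_family w \<Omega>. r = Re (deriv h 0))"

definition hurwitz_density :: "complex set \<Rightarrow> complex \<Rightarrow> real" where
  "hurwitz_density \<Omega> w = 2 / hurwitz_radius \<Omega> w"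

text \<open>Lengths of the polygons inscribed in \<open>\<gamma>\<close> over the interval from \<open>a\<close> to \<open>b\<close>. The partitions
  need not contain the endpoints \<open>a\<close> and \<open>b\<close>; adding them does not change the supremum.\<close>

definition polygon_lengths :: "(real \<Rightarrow> complex) \<Rightarrow> real \<Rightarrow> real \<Rightarrow> real set" where
  "polygon_lengths \<gamma> a b =
     {\<Sum>i<length ts - 1. dist (\<gamma> (ts ! i)) (\<gamma> (ts ! Suc i)) | ts. sorted ts \<and> set ts \<subseteq> {a..b}}"

definition rectifiable_path :: "(real \<Rightarrow> complex) \<Rightarrow> bool" where
  "rectifiable_path \<gamma> \<longleftrightarrow> path \<gamma> \<and> bdd_above (polygon_lengths \<gamma> 0 1)"

definition arc_length :: "(real \<Rightarrow> complex) \<Rightarrow> real \<Rightarrow> real" where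
  "arc_length \<gamma> t = Sup (polygon_lengths \<gamma> 0 t)"

text \<open>For a rectifiable path, arc length is a continuous nondecreasing function on the unit
  interval; the integral of \<open>\<rho>\<close> along \<open>\<gamma>\<close> with respect to \<open>|dw|\<close> is the integral of
  \<open>\<rho> \<circ> \<gamma>\<close> against the associated Lebesgue--Stieltjes measure. The library measure needs a
  function on all of the reals, so arc length is extended by constants outside the unit interval.\<close>

definition arc_integral :: "(complex \<Rightarrow> real) \<Rightarrow> (real \<Rightarrow> complex) \<Rightarrow> ennreal" where
  "arc_integral \<rho> \<gamma> =
     (\<integral>\<^sup>+t\<in>{0..1}. ennreal (\<rho> (\<gamma> t)) \<partial>interval_measure (\<lambda>t. arc_length \<gamma> (max 0 (min t 1))))"

text \<open>Outside \<open>\<Omega>\<close> the infimum is over the empty set, hence infinite, and \<open>enn2real\<close> maps it to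
  0; within \<open>\<Omega>\<close>, an infinite infimum for distinct points would contradict the metric axioms.\<close>

definition hurwitz_dist :: "complex set \<Rightarrow> complex \<Rightarrow> complex \<Rightarrow> real" where
  "hurwitz_dist \<Omega> w1 w2 = enn2real
     (INF \<gamma>\<in>{\<gamma>. rectifiable_path \<gamma> \<and> path_image \<gamma> \<subseteq> \<Omega> \<and> pathstart \<gamma> = w1 \<and> pathfinish \<gamma> = w2}.
        arc_integral (hurwitz_density \<Omega>) \<gamma>)"

end

theory Submission
  imports Defs "HOL-Complex_Analysis.Great_Picard"
begin

text \<open>Let \<open>h\<close> be admissible at \<open>w\<close> and let \<open>a\<close> be omitted by \<open>\<Omega>\<close>. The square root \<open>s\<close> of
  \<open>(h - a) / (w - a)\<close> with \<open>s(0) = 1\<close> omits \<open>0\<close> and \<open>-1\<close>, so Schottky's theorem bounds it on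
  compact subsets of the disc by absolute constants. Hence the admissible functions form a normal
  family, which together with Hurwitz's theorem shows that the maximum \<open>r(w)\<close> exists and is upper
  semicontinuous in \<open>w\<close>; moreover \<open>\<delta>(w) \<le> r(w) \<le> C \<delta>(w)\<close>, where \<open>\<delta>(w)\<close> is the distance from
  \<open>w\<close> to the complement of \<open>\<Omega>\<close>. The Hurwitz density is therefore comparable to \<open>1 / \<delta>\<close>, so that
  the points at a sufficiently small Hurwitz distance from \<open>x\<close> lie in the disc of
  radius \<open>\<delta>(x) / 2\<close> about \<open>x\<close>, where the Hurwitz and Euclidean metrics are equivalent.\<close>

subsection \<open>Extremal functions\<close>

lemma hurwitz_family_iff:
  "h \<in> hurwitz_family w \<Omega> \<longleftrightarrow> h holomorphic_on ball 0 1 \<and> h ` ball 0 1 \<subseteq> \<Omega> \<and> h 0 = w \<and>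
     (\<forall>t\<in>ball 0 1 - {0}. h t \<noteq> w) \<and> deriv h 0 \<in> \<real> \<and> Re (deriv h 0) > 0"
  by (simp add: hurwitz_family_def)

text \<open>The square root omits \<open>-1\<close> because \<open>h\<close> takes the value \<open>w\<close> only at the origin; rescaling
  by \<open>\<rho> < 1\<close> is needed since Schottky's theorem is about functions on the closed disc.\<close>

lemma hurwitz_family_growth:
  fixes t :: real
  assumes t: "0 < t" "t < 1"
  shows "\<exists>B>0. \<forall>\<Omega> w a h z. h \<in> hurwitz_family w \<Omega> \<longrightarrow> a \<notin> \<Omega> \<longrightarrow> norm z \<le> t \<longrightarrow>
           norm (h z - a) \<le> B * dist w a"
proof -
  define \<rho> where "\<rho> = (1 + t) / 2"
  have \<rho>: "0 < \<rho>" "\<rho> < 1" "t < \<rho>" using t by (auto simp: \<rho>_def)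
  \<comment> \<open>The bound of Schottky's theorem for a function of modulus at most 1 at the
    origin, on the disc of radius \<open>t / \<rho>\<close> to which the rescaling carries the disc
    of radius \<open>t\<close>.\<close>
  define B where "B = exp (pi * exp (pi * (2 + 2 * 1 + 12 * (t / \<rho>) / (1 - t / \<rho>))))"
  have "norm (h z - a) \<le> B\<^sup>2 * dist w a"
    if h: "h \<in> hurwitz_family w \<Omega>" and a: "a \<notin> \<Omega>" and z: "norm z \<le> t" for \<Omega> w a h z
  proof -
    have hol: "h holomorphic_on ball 0 1" and sub: "h ` ball 0 1 \<subseteq> \<Omega>" and h0: "h 0 = w"
      and inj: "\<And>u. u \<in> ball 0 1 \<Longrightarrow> u \<noteq> 0 \<Longrightarrow> h u \<noteq> w"
      using h by (auto simp: hurwitz_family_iff)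
    have na: "h u \<noteq> a" if "u \<in> ball 0 1" for u using sub a that by blast
    have "w \<noteq> a" using na[of 0] h0 by auto
    obtain g where g: "g holomorphic_on ball 0 1"
      "\<And>u. u \<in> ball 0 1 \<Longrightarrow> exp (g u) = h u - a"
      by (rule holomorphic_logarithm_exists[of "ball (0::complex) 1" "\<lambda>u. h u - a" 0])
        (use na in \<open>auto intro!: holomorphic_intros hol\<close>)
    define s where "s u = exp ((g u - g 0) / 2)" for u
    have s2: "(s u)\<^sup>2 * (w - a) = h u - a" if "u \<in> ball 0 1" for u
    proof -
      have "(s u)\<^sup>2 = exp (g u) / exp (g 0)"
        by (simp add: s_def power2_eq_square exp_diff[symmetric] flip: exp_add)
      thus ?thesis using g(2)[OF that] g(2)[of 0] h0 \<open>w \<noteq> a\<close> by simp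
    qed
    \<comment> \<open>Schottky's theorem concerns functions omitting 0 and 1; the sign turns the
      omitted value -1 into 1.\<close>
    define f where "f u = - s (of_real \<rho> * u)" for u
    have inball: "of_real \<rho> * u \<in> ball 0 1" if "norm u \<le> 1" for u :: complex
      using le_less_trans[OF mult_left_le[OF that, of \<rho>]] \<rho> by (simp add: norm_mult)
    have "(g \<circ> (\<lambda>u. of_real \<rho> * u)) holomorphic_on cball 0 1"
      by (rule holomorphic_on_compose_gen[OF _ g(1)]) (use inball in \<open>auto intro!: holomorphic_intros\<close>)
    hence f_hol: "f holomorphic_on cball 0 1"
      unfolding f_def s_def o_def by (intro holomorphic_intros) auto
    have "\<not> (f u = 0 \<or> f u = 1)" if "u \<in> cball 0 1" for u
    proof -
      have "s (of_real \<rho> * u) \<noteq> 0" by (simp add: s_def)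
      moreover have "s (of_real \<rho> * u) \<noteq> -1"
      proof
        assume *: "s (of_real \<rho> * u) = -1"
        have "h (of_real \<rho> * u) = w" using s2[OF inball[of u]] * that by auto
        hence "of_real \<rho> * u = 0" using inj inball[of u] that by (metis mem_cball_0)
        from *[unfolded this] show False by (simp add: s_def)
      qed
      ultimately show ?thesis by (simp add: f_def minus_equation_iff[of _ 1])
    qed
    moreover have "norm (f 0) \<le> 1" by (simp add: f_def s_def)
    ultimately have "norm (f (z / of_real \<rho>)) \<le> B"
      unfolding B_def using f_hol \<rho> t z
      by (intro Schottky) (auto simp: norm_divide divide_simps)
    hence "norm (s z) \<le> B" using \<rho> by (simp add: f_def)
    moreover have "z \<in> ball 0 1" using z t by auto
    ultimately show ?thesis
      using s2[of z] by (auto simp: dist_norm norm_mult norm_power intro!: mult_right_mono power_mono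
          simp flip: s2)
  qed
  moreover have "B\<^sup>2 > 0" by (simp add: B_def)
  ultimately show ?thesis by blast
qed

text \<open>Cauchy's inequality on the circle of radius 1/2, applied to \<open>h - a\<close>. One
  constant serves all domains and all omitted points, so that \<open>a\<close> can later be chosen
  nearest to a given point.\<close>

lemma hurwitz_family_deriv_le:
  "\<exists>C>0. \<forall>\<Omega> w a h. h \<in> hurwitz_family w \<Omega> \<longrightarrow> a \<notin> \<Omega> \<longrightarrow> Re (deriv h 0) \<le> C * dist w a"
proof -
  obtain B where B: "B > 0" "\<And>\<Omega> w a h z. h \<in> hurwitz_family w \<Omega> \<Longrightarrow> a \<notin> \<Omega> \<Longrightarrow> norm z \<le> 1/2 \<Longrightarrow>
           norm (h z - a) \<le> B * dist w a"
    using hurwitz_family_growth[of "1/2"] by auto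
  have "Re (deriv h 0) \<le> (2 * B) * dist w a" if h: "h \<in> hurwitz_family w \<Omega>" and a: "a \<notin> \<Omega>" for \<Omega> w a h
  proof -
    have hol: "h holomorphic_on ball 0 1" using h by (auto simp: hurwitz_family_iff)
    hence hd: "h field_differentiable at 0"
      using holomorphic_on_imp_differentiable_at[of h "ball 0 1" 0] by auto
    have sub: "cball 0 (1/2) \<subseteq> ball (0::complex) 1" by auto
    have "(\<lambda>u. h u - a) holomorphic_on ball 0 1" by (intro holomorphic_intros hol)
    hence hol': "(\<lambda>u. h u - a) holomorphic_on cball 0 (1/2)" using sub holomorphic_on_subset by blast
    have "norm ((deriv ^^ 1) (\<lambda>u. h u - a) 0) \<le> fact 1 * (B * dist w a) / (1/2)^1"
      by (rule Cauchy_inequality)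
        (use hol' B(2)[OF h a] in \<open>auto intro: holomorphic_on_imp_continuous_on holomorphic_on_subset\<close>)
    moreover have "deriv (\<lambda>u. h u - a) 0 = deriv h 0" using hd by simp
    ultimately show ?thesis using complex_Re_le_cmod[of "deriv h 0"] by simp
  qed
  thus ?thesis using \<open>B > 0\<close> by (intro exI[of _ "2 * B"]) simp
qed

text \<open>The affine map onto an inscribed disc is the competitor behind the lower bound for the
  Hurwitz radius.\<close>

lemma affine_in_hurwitz_family:
  assumes "ball w d \<subseteq> \<Omega>" "d > 0"
  shows "(\<lambda>t. w + of_real d * t) \<in> hurwitz_family w \<Omega>" "deriv (\<lambda>t. w + of_real d * t) 0 = of_real d"
proof -
  have "((\<lambda>t. w + of_real d * t) has_field_derivative of_real d) (at 0)"
    by (auto intro!: derivative_eq_intros)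
  thus d: "deriv (\<lambda>t. w + of_real d * t) 0 = of_real d" by (rule DERIV_imp_deriv)
  have "w + of_real d * t \<in> ball w d" if "norm t < 1" for t :: complex
    using that assms(2) by (simp add: dist_norm norm_mult)
  thus "(\<lambda>t. w + of_real d * t) \<in> hurwitz_family w \<Omega>"
    using assms d by (auto simp: hurwitz_family_iff intro!: holomorphic_intros)
qed

text \<open>Montel's theorem gives a limit function; its derivative \<open>c > 0\<close> at the
  origin makes it nonconstant, so Hurwitz's theorem preserves the omitted values. The base points
  vary because the lemma serves for semicontinuity of the radius as well as for the existence of
  extremal functions.\<close>

lemma hurwitz_family_compact:
  assumes a: "a \<notin> \<Omega>" and w: "W \<longlonglongrightarrow> w" and c: "c > 0"
    and h: "\<And>n. h n \<in> hurwitz_family (W n) \<Omega>"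
    and lim: "(\<lambda>n. Re (deriv (h n) 0)) \<longlonglongrightarrow> c"
  obtains g where "g \<in> hurwitz_family w \<Omega>" "Re (deriv g 0) = c"
proof -
  have hol: "h n holomorphic_on ball 0 1" and sub: "h n ` ball 0 1 \<subseteq> \<Omega>" and h0: "h n 0 = W n"
    and inj: "t \<in> ball 0 1 - {0} \<Longrightarrow> h n t \<noteq> W n" and real: "deriv (h n) 0 \<in> \<real>" for n t
    using h by (auto simp: hurwitz_family_iff)
  obtain M where M: "\<And>n. norm (W n) \<le> M"
    using convergent_imp_Bseq[of W] w by (metis Bseq_def convergentI)
  \<comment> \<open>The growth bound is uniform in \<open>n\<close> because the convergent base
    points \<open>W n\<close> are bounded.\<close>
  have bounded: "\<exists>B. \<forall>f\<in>range h. \<forall>z\<in>K. norm (f z) \<le> B" if K: "compact K" "K \<subseteq> ball 0 1" for K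
  proof -
    have "\<exists>t. 0 < t \<and> t < 1 \<and> K \<subseteq> cball 0 t"
    proof (cases "K = {}")
      case True thus ?thesis by (intro exI[of _ "1/2"]) auto
    next
      case False
      obtain x where x: "x \<in> K" "\<And>y. y \<in> K \<Longrightarrow> norm y \<le> norm x"
        using continuous_attains_sup[OF K(1) False, of norm] continuous_on_norm_id by auto
      hence "norm x < 1" using K(2) by auto
      thus ?thesis using x by (intro exI[of _ "(norm x + 1) / 2"]) (auto simp: field_simps add_pos_nonneg intro: order_trans, smt (verit) norm_ge_zero)
    qed
    then obtain t where t: "0 < t" "t < 1" "K \<subseteq> cball 0 t" by blast
    obtain B where B: "B > 0" "\<And>\<Omega> w a h z. h \<in> hurwitz_family w \<Omega> \<Longrightarrow> a \<notin> \<Omega> \<Longrightarrow> norm z \<le> t \<Longrightarrow>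
           norm (h z - a) \<le> B * dist w a"
      using hurwitz_family_growth[OF t(1,2)] by metis
    have "norm (h n z) \<le> B * (M + norm a) + norm a" if "z \<in> K" for n z
    proof -
      have "norm (h n z - a) \<le> B * dist (W n) a" using B(2)[OF h a] t(3) that by auto
      also have "\<dots> \<le> B * (M + norm a)"
        using B(1) M[of n] norm_triangle_ineq4[of "W n" a] by (intro mult_left_mono) (auto simp: dist_norm)
      finally show ?thesis using norm_triangle_ineq2[of "h n z" a] by simp
    qed
    thus ?thesis by blast
  qed
  obtain g r where g: "g holomorphic_on ball 0 1" and r: "strict_mono (r :: nat \<Rightarrow> nat)"
    and ptw: "\<And>x. x \<in> ball 0 1 \<Longrightarrow> (\<lambda>n. h (r n) x) \<longlonglongrightarrow> g x"
    and ul: "\<And>K. compact K \<Longrightarrow> K \<subseteq> ball 0 1 \<Longrightarrow> uniform_limit K (h \<circ> r) g sequentially"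
    by (rule Montel[of "ball 0 1" "range h" h]) (use hol bounded in auto)
  have Wr: "(\<lambda>n. W (r n)) \<longlonglongrightarrow> w" using LIMSEQ_subseq_LIMSEQ[OF w r] by (simp add: o_def)
  have g0: "g 0 = w" using LIMSEQ_unique[OF ptw[of 0]] Wr by (simp add: h0)
  have der: "(\<lambda>n. deriv ((h \<circ> r) n) 0) \<longlonglongrightarrow> deriv g 0"
  proof (rule deriv_complex_uniform_limit)
    have "uniform_limit (cball 0 (1/2)) (h \<circ> r) g sequentially" by (rule ul) auto
    thus "uniform_limit (ball 0 (1/2)) (h \<circ> r) g sequentially"
      by (rule uniform_limit_on_subset) auto
    have "h (r n) holomorphic_on ball 0 (1/2)" for n
      by (rule holomorphic_on_subset[OF hol]) auto
    thus "\<forall>\<^sub>F n in sequentially. (h \<circ> r) n holomorphic_on ball 0 (1/2)" by simp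
  qed auto
  have "(\<lambda>n. deriv ((h \<circ> r) n) 0) = (\<lambda>n. of_real (Re (deriv (h (r n)) 0)))"
    using real by (auto simp: of_real_Re)
  moreover have "(\<lambda>n. of_real (Re (deriv (h (r n)) 0)) :: complex) \<longlonglongrightarrow> of_real c"
    using LIMSEQ_subseq_LIMSEQ[OF lim r] by (intro tendsto_of_real) (simp add: o_def)
  ultimately have dg: "deriv g 0 = of_real c" using LIMSEQ_unique[OF der] by simp
  have gd: "(g has_field_derivative of_real c) (at 0)"
    using holomorphic_derivI[OF g, of 0] dg by auto
  \<comment> \<open>Hurwitz's theorem is applied on the disc and on the punctured disc, so
    nonconstancy is shown on the smaller set. A constant value there would extend to the origin by
    continuity and force the derivative to vanish.\<close>
  have nonconst: "\<not> (\<lambda>z. g z - b) constant_on ball 0 1 - {0}" for b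
  proof
    assume "(\<lambda>z. g z - b) constant_on ball 0 1 - {0}"
    then obtain k where k: "\<And>z. z \<in> ball 0 1 - {0} \<Longrightarrow> g z = k"
      unfolding constant_on_def by (metis diff_add_cancel)
    have ev: "\<forall>\<^sub>F z in at 0. g z = k"
      using k by (auto simp: eventually_at intro!: exI[of _ 1])
    have "g \<midarrow>0\<rightarrow> g 0" using gd DERIV_isCont isCont_def by blast
    moreover have "g \<midarrow>0\<rightarrow> k" using tendsto_eventually[OF ev] .
    ultimately have "g 0 = k" using LIM_unique by blast
    with k have "\<And>z. z \<in> ball 0 1 \<Longrightarrow> g z = k" by (metis Diff_iff singletonD)
    hence "(g has_field_derivative 0) (at 0)"
      by (intro has_field_derivative_transform_within_open[OF DERIV_const[of k], of "ball 0 1"]) auto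
    thus False using gd DERIV_unique c by (metis of_real_eq_0_iff less_irrefl)
  qed
  have g_in: "g z \<in> \<Omega>" if "z \<in> ball 0 1" for z
  proof (rule ccontr)
    assume b: "g z \<notin> \<Omega>"
    \<comment> \<open>The approximants \<open>h (r n) - g z\<close> have no zeros, since
      \<open>g z\<close> is assumed to lie outside \<Omega>.\<close>
    have "(\<lambda>u. g u - g z) z \<noteq> 0"
    proof (rule Hurwitz_no_zeros[of "ball 0 1" "\<lambda>n u. h (r n) u - g z" "\<lambda>u. g u - g z" z])
      show "\<not> (\<lambda>u. g u - g z) constant_on ball 0 1"
        using nonconst constant_on_subset by (metis Diff_subset)
      show "uniform_limit K (\<lambda>n u. h (r n) u - g z) (\<lambda>u. g u - g z) sequentially"
        if "compact K" "K \<subseteq> ball 0 1" for K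
        using ul[OF that] by (intro uniform_limit_intros) (simp_all add: o_def)
      show "h (r n) u - g z \<noteq> 0" if "u \<in> ball 0 1" for n u using sub[of "r n"] b that by force
    qed (use that in \<open>auto intro!: holomorphic_intros hol g\<close>)
    thus False by simp
  qed
  have g_inj: "g z \<noteq> w" if "z \<in> ball 0 1 - {0}" for z
  proof -
    \<comment> \<open>Deleting the origin removes the only zero of \<open>h (r n) - W (r n)\<close>.
      The subtracted constants vary with \<open>n\<close> and tend to \<open>w\<close>.\<close>
    have "(\<lambda>u. g u - w) z \<noteq> 0"
    proof (rule Hurwitz_no_zeros[of "ball 0 1 - {0}" "\<lambda>n u. h (r n) u - W (r n)" "\<lambda>u. g u - w" z])
      show "connected (ball (0::complex) 1 - {0})" by (rule connected_open_delete) auto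
      show "\<not> (\<lambda>u. g u - w) constant_on ball 0 1 - {0}" by (rule nonconst)
      show "uniform_limit K (\<lambda>n u. h (r n) u - W (r n)) (\<lambda>u. g u - w) sequentially"
        if "compact K" "K \<subseteq> ball 0 1 - {0}" for K
        using ul[of K] that Wr
        by (intro uniform_limit_intros) (auto simp: o_def uniform_limit_iff tendsto_iff)
      show "h (r n) u - W (r n) \<noteq> 0" if "u \<in> ball 0 1 - {0}" for n u using inj[OF that] by auto
    qed (use that in \<open>auto intro!: holomorphic_intros holomorphic_on_subset[OF hol] holomorphic_on_subset[OF g]\<close>)
    thus ?thesis by simp
  qed
  have "g \<in> hurwitz_family w \<Omega>"
    using g g_in g0 g_inj dg c by (auto simp: hurwitz_family_iff)
  thus thesis using that dg by simp
qed

text \<open>The derivative bound makes the supremum finite and an inscribed disc makes it positive;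
  a maximizing sequence with fixed base point then has an admissible limit. Hence
  \<open>GREATEST\<close> in the definition denotes a true maximum.\<close>

lemma hurwitz_radius_attained:
  assumes "open \<Omega>" "w \<in> \<Omega>" "a \<notin> \<Omega>"
  shows "\<exists>h\<in>hurwitz_family w \<Omega>. Re (deriv h 0) = hurwitz_radius \<Omega> w"
    and "h \<in> hurwitz_family w \<Omega> \<Longrightarrow> Re (deriv h 0) \<le> hurwitz_radius \<Omega> w"
proof -
  define R where "R = (\<lambda>h. Re (deriv h 0)) ` hurwitz_family w \<Omega>"
  obtain d where d: "d > 0" "ball w d \<subseteq> \<Omega>" using assms open_contains_ball by blast
  have dR: "d \<in> R" unfolding R_def using affine_in_hurwitz_family[OF d(2,1)] by force
  have bdd: "bdd_above R"
    using hurwitz_family_deriv_le assms(3) unfolding R_def bdd_above_def by blast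
  have pos: "Sup R > 0" using cSup_upper[OF dR bdd] d(1) by simp
  have "Sup R \<in> closure R" using closure_contains_Sup bdd dR by blast
  then obtain c where c: "\<And>n. c n \<in> R" "c \<longlonglongrightarrow> Sup R" unfolding closure_sequential by blast
  have "\<forall>n. \<exists>h\<in>hurwitz_family w \<Omega>. Re (deriv h 0) = c n" using c(1) unfolding R_def image_iff by metis
  then obtain f where f: "\<And>n. f n \<in> hurwitz_family w \<Omega>" "\<And>n. Re (deriv (f n) 0) = c n" by metis
  obtain g where g: "g \<in> hurwitz_family w \<Omega>" "Re (deriv g 0) = Sup R"
    by (rule hurwitz_family_compact[OF assms(3) tendsto_const pos f(1)]) (use c f in auto)
  have le: "Re (deriv f 0) \<le> Sup R" if "f \<in> hurwitz_family w \<Omega>" for f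
    using cSup_upper[OF _ bdd] that by (auto simp: R_def)
  have eq: "hurwitz_radius \<Omega> w = Sup R"
    unfolding hurwitz_radius_def by (rule Greatest_equality) (use g le in \<open>auto intro!: bexI[of _ g]\<close>)
  show "\<exists>h\<in>hurwitz_family w \<Omega>. Re (deriv h 0) = hurwitz_radius \<Omega> w" using g eq by auto
  show "Re (deriv h 0) \<le> hurwitz_radius \<Omega> w" if "h \<in> hurwitz_family w \<Omega>" using le[OF that] eq by simp
qed

lemma hurwitz_radius_pos:
  assumes "open \<Omega>" "w \<in> \<Omega>" "a \<notin> \<Omega>"
  shows "hurwitz_radius \<Omega> w > 0"
  using hurwitz_radius_attained(1)[OF assms] by (auto simp: hurwitz_family_iff)

lemma hurwitz_radius_ge:
  assumes "open \<Omega>" "a \<notin> \<Omega>" "ball w d \<subseteq> \<Omega>" "d > 0"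
  shows "d \<le> hurwitz_radius \<Omega> w"
proof -
  have "w \<in> \<Omega>" using assms by auto
  from hurwitz_radius_attained(2)[OF assms(1) this assms(2) affine_in_hurwitz_family(1)[OF assms(3,4)]]
  show ?thesis unfolding affine_in_hurwitz_family(2)[OF assms(3,4)] by simp
qed

lemma hurwitz_radius_le:
  "\<exists>C>0. \<forall>\<Omega> w a. open \<Omega> \<longrightarrow> w \<in> \<Omega> \<longrightarrow> a \<notin> \<Omega> \<longrightarrow> hurwitz_radius \<Omega> w \<le> C * dist w a"
  using hurwitz_family_deriv_le hurwitz_radius_attained(1) by metis

text \<open>The radius is upper semicontinuous: limits of extremal functions are admissible, so its
  superlevel sets are relatively closed in \<Omega>. Extension by zero makes the density a function
  on the whole plane.\<close>

lemma hurwitz_density_measurable: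
  assumes \<Omega>: "open \<Omega>" and a: "a \<notin> \<Omega>"
  shows "(\<lambda>w. if w \<in> \<Omega> then hurwitz_density \<Omega> w else 0) \<in> borel_measurable borel"
proof -
  define r where "r w = (if w \<in> \<Omega> then hurwitz_radius \<Omega> w else 0)" for w
  obtain C where C: "\<And>w. w \<in> \<Omega> \<Longrightarrow> hurwitz_radius \<Omega> w \<le> C * dist w a"
    using hurwitz_radius_le \<Omega> a by meson
  have "{w. c \<le> r w} \<in> sets borel" for c
  proof (cases "c \<le> 0")
    case True
    hence "{w. c \<le> r w} = UNIV"
      using hurwitz_radius_pos[OF \<Omega> _ a] by (auto simp: r_def intro: order_trans less_imp_le)
    thus ?thesis by simp
  next
    case False
    define A where "A = {w. c \<le> r w}"
    have A: "w \<in> A \<longleftrightarrow> w \<in> \<Omega> \<and> c \<le> hurwitz_radius \<Omega> w" for w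
      using False by (auto simp: A_def r_def)
    have "w \<in> A" if w: "w \<in> \<Omega>" "w \<in> closure A" for w
    proof -
      obtain W where W: "\<And>n. W n \<in> A" "W \<longlonglongrightarrow> w" using w(2) unfolding closure_sequential by blast
      \<comment> \<open>The radii at the points \<open>W n\<close> lie between \<open>c\<close> and
        a common upper bound, so a subsequence of them converges, to a limit that is at least
        \<open>c\<close> and hence positive.\<close>
      have "(\<lambda>n. C * dist (W n) a) \<longlonglongrightarrow> C * dist w a" by (intro tendsto_intros W)
      then obtain M where M: "\<And>n. norm (C * dist (W n) a) \<le> M"
        using convergent_imp_Bseq by (metis Bseq_def convergentI)
      have "hurwitz_radius \<Omega> (W n) \<in> {c..M}" for n
        using W(1)[of n] C[of "W n"] M[of n] unfolding A by auto
      then obtain l k where l: "l \<in> {c..M}" and k: "strict_mono (k::nat\<Rightarrow>nat)"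
          "(\<lambda>n. hurwitz_radius \<Omega> (W (k n))) \<longlonglongrightarrow> l"
        using seq_compactE[of "{c..M}" "\<lambda>n. hurwitz_radius \<Omega> (W n)"]
        by (auto simp: compact_imp_seq_compact o_def)
      have "\<forall>n. \<exists>h\<in>hurwitz_family (W (k n)) \<Omega>. Re (deriv h 0) = hurwitz_radius \<Omega> (W (k n))"
        using hurwitz_radius_attained(1)[OF \<Omega> _ a] W(1) A by blast
      then obtain h where h: "\<And>n. h n \<in> hurwitz_family (W (k n)) \<Omega>"
          "\<And>n. Re (deriv (h n) 0) = hurwitz_radius \<Omega> (W (k n))" by metis
      have "l > 0" using l False by auto
      have Wk: "(\<lambda>n. W (k n)) \<longlonglongrightarrow> w" using LIMSEQ_subseq_LIMSEQ[OF W(2) k(1)] by (simp add: o_def)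
      obtain g where "g \<in> hurwitz_family w \<Omega>" "Re (deriv g 0) = l"
        by (rule hurwitz_family_compact[OF a Wk \<open>l > 0\<close> h(1)]) (use h k in auto)
      hence "l \<le> hurwitz_radius \<Omega> w" using hurwitz_radius_attained(2)[OF \<Omega> w(1) a] by force
      thus ?thesis using l w(1) A by auto
    qed
    hence "A = \<Omega> \<inter> closure A" using A closure_subset by blast
    also have "\<dots> \<in> sets borel" using \<Omega> by auto
    finally show ?thesis by (simp add: A_def)
  qed
  hence "r \<in> borel_measurable borel" by (subst borel_measurable_iff_ge) auto
  hence "(\<lambda>w. 2 / r w) \<in> borel_measurable borel" by measurable
  \<comment> \<open>Off \<Omega> both sides vanish because \<open>2 / 0 = 0\<close>.\<close>
  moreover have "(\<lambda>w. 2 / r w) = (\<lambda>w. if w \<in> \<Omega> then hurwitz_density \<Omega> w else 0)"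
    by (auto simp: r_def hurwitz_density_def)
  ultimately show ?thesis by simp
qed

subsection \<open>Arc length\<close>

definition polygon_length :: "(real \<Rightarrow> complex) \<Rightarrow> real list \<Rightarrow> real" where
  "polygon_length \<gamma> ts = (\<Sum>i<length ts - 1. dist (\<gamma> (ts ! i)) (\<gamma> (ts ! Suc i)))"

text \<open>A free left endpoint allows additivity of arc length to be stated.\<close>

definition variation :: "(real \<Rightarrow> complex) \<Rightarrow> real \<Rightarrow> real \<Rightarrow> real" where
  "variation \<gamma> a b = Sup (polygon_lengths \<gamma> a b)"

lemma arc_length_eq_variation: "arc_length \<gamma> t = variation \<gamma> 0 t"
  by (simp add: arc_length_def variation_def)

lemma polygon_lengths_eq:
  "polygon_lengths \<gamma> a b = polygon_length \<gamma> ` {ts. sorted ts \<and> set ts \<subseteq> {a..b}}"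
  by (auto simp: polygon_lengths_def polygon_length_def)

lemma polygon_length_simps [simp]:
  "polygon_length \<gamma> [] = 0"
  "polygon_length \<gamma> [t] = 0"
  "polygon_length \<gamma> (t # u # ts) = dist (\<gamma> t) (\<gamma> u) + polygon_length \<gamma> (u # ts)"
  by (simp_all add: polygon_length_def sum.lessThan_Suc_shift del: sum.lessThan_Suc)

lemma polygon_length_Cons_ge: "polygon_length \<gamma> ts \<le> polygon_length \<gamma> (t # ts)"
  by (cases ts) auto

lemma polygon_length_append:
  "polygon_length \<gamma> (xs @ [u]) + polygon_length \<gamma> (u # ys) = polygon_length \<gamma> (xs @ u # ys)"
  by (induction xs rule: induct_list012) auto

lemma polygon_length_append_ge:
  "polygon_length \<gamma> xs + polygon_length \<gamma> ys \<le> polygon_length \<gamma> (xs @ ys)"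
proof (induction xs rule: induct_list012)
  case (2 x) show ?case using polygon_length_Cons_ge by simp
qed auto

text \<open>Triangle inequality: the edge joining \<open>xs\<close> to \<open>ys\<close> is replaced
  by two edges through \<open>u\<close>.\<close>

lemma polygon_length_insert:
  "polygon_length \<gamma> (xs @ ys) \<le> polygon_length \<gamma> (xs @ [u]) + polygon_length \<gamma> (u # ys)"
proof (induction xs rule: induct_list012)
  case 1 show ?case using polygon_length_Cons_ge by simp
next
  case (2 x) show ?case
    by (cases ys) (auto simp: dist_triangle)
qed auto

lemma polygon_length_map: "polygon_length \<gamma> (map \<phi> ts) = polygon_length (\<lambda>t. \<gamma> (\<phi> t)) ts"
  by (induction ts rule: induct_list012) auto

lemma polygon_length_rev: "polygon_length \<gamma> (rev ts) = polygon_length \<gamma> ts"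
proof (induction ts rule: induct_list012)
  case (3 x y zs)
  have "polygon_length \<gamma> (rev (x # y # zs)) = polygon_length \<gamma> (rev zs @ [y]) + polygon_length \<gamma> [y, x]"
    using polygon_length_append[of \<gamma> "rev zs" y "[x]"] by simp
  thus ?case using 3 by (simp add: dist_commute)
qed auto

lemma polygon_length_cong:
  "(\<And>t. t \<in> set ts \<Longrightarrow> \<gamma> t = \<gamma>' t) \<Longrightarrow> polygon_length \<gamma> ts = polygon_length \<gamma>' ts"
  by (induction ts rule: induct_list012) auto

lemma polygon_lengths_cong:
  "(\<And>t. t \<in> {a..b} \<Longrightarrow> \<gamma> t = \<gamma>' t) \<Longrightarrow> polygon_lengths \<gamma> a b = polygon_lengths \<gamma>' a b"
  unfolding polygon_lengths_eq by (intro image_cong refl polygon_length_cong) auto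

lemma polygon_lengths_reflect_subset:
  "polygon_lengths (\<lambda>t. \<gamma> (d - t)) a b \<subseteq> polygon_lengths \<gamma> (d - b) (d - a)"
proof
  fix l assume "l \<in> polygon_lengths (\<lambda>t. \<gamma> (d - t)) a b"
  then obtain ts where ts: "sorted ts" "set ts \<subseteq> {a..b}" "l = polygon_length (\<lambda>t. \<gamma> (d - t)) ts"
    by (auto simp: polygon_lengths_eq)
  have "l = polygon_length \<gamma> (rev (map (\<lambda>t. d - t) ts))"
    by (simp add: ts polygon_length_rev polygon_length_map)
  moreover have "sorted (rev (map (\<lambda>t. d - t) ts))"
    using ts(1) by (auto simp: sorted_wrt_rev sorted_wrt_map)
  moreover have "set (rev (map (\<lambda>t. d - t) ts)) \<subseteq> {d - b..d - a}" using ts(2) by auto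
  ultimately show "l \<in> polygon_lengths \<gamma> (d - b) (d - a)" unfolding polygon_lengths_eq by blast
qed

text \<open>The reflection is an involution, so the inclusion applied to the reflected path is the
  converse inclusion.\<close>

lemma polygon_lengths_reflect:
  "polygon_lengths (\<lambda>t. \<gamma> (d - t)) a b = polygon_lengths \<gamma> (d - b) (d - a)"
  using polygon_lengths_reflect_subset[of \<gamma> d a b]
    polygon_lengths_reflect_subset[of "\<lambda>t. \<gamma> (d - t)" d "d - b" "d - a"] by simp

lemma polygon_lengths_affine_subset:
  assumes "c > 0"
  shows "polygon_lengths (\<lambda>t. \<gamma> (c * t + d)) a b \<subseteq> polygon_lengths \<gamma> (c * a + d) (c * b + d)"
proof
  fix l assume "l \<in> polygon_lengths (\<lambda>t. \<gamma> (c * t + d)) a b"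
  then obtain ts where ts: "sorted ts" "set ts \<subseteq> {a..b}" "l = polygon_length (\<lambda>t. \<gamma> (c * t + d)) ts"
    by (auto simp: polygon_lengths_eq)
  have "l = polygon_length \<gamma> (map (\<lambda>t. c * t + d) ts)"
    by (simp add: ts polygon_length_map)
  moreover have "sorted (map (\<lambda>t. c * t + d) ts)"
    using ts(1) assms by (auto simp: sorted_wrt_map)
  moreover have "set (map (\<lambda>t. c * t + d) ts) \<subseteq> {c * a + d..c * b + d}" using ts(2) assms by auto
  ultimately show "l \<in> polygon_lengths \<gamma> (c * a + d) (c * b + d)" unfolding polygon_lengths_eq by blast
qed

lemma polygon_lengths_affine:
  assumes "c > 0"
  shows "polygon_lengths (\<lambda>t. \<gamma> (c * t + d)) a b = polygon_lengths \<gamma> (c * a + d) (c * b + d)"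
proof -
  have "(\<lambda>t. \<gamma> (c * (1 / c * t + - d / c) + d)) = \<gamma>" using assms by (simp add: field_simps)
  moreover have "1 / c * (c * x + d) + - d / c = x" for x using assms by (simp add: field_simps)
  ultimately show ?thesis
    using polygon_lengths_affine_subset[OF assms, of \<gamma> d a b] assms
      polygon_lengths_affine_subset[of "1 / c" "\<lambda>t. \<gamma> (c * t + d)" "- d / c" "c * a + d" "c * b + d"]
    by auto
qed

lemma polygon_lengths_nonempty: "0 \<in> polygon_lengths \<gamma> a b"
  unfolding polygon_lengths_eq by (rule image_eqI[of _ _ "[]"]) auto

lemma polygon_lengths_mono:
  "a' \<le> a \<Longrightarrow> b \<le> b' \<Longrightarrow> polygon_lengths \<gamma> a b \<subseteq> polygon_lengths \<gamma> a' b'"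
  unfolding polygon_lengths_eq by (rule image_mono) (use order_trans in auto)

lemma bdd_above_polygon_lengths_mono:
  "bdd_above (polygon_lengths \<gamma> a' b') \<Longrightarrow> a' \<le> a \<Longrightarrow> b \<le> b' \<Longrightarrow> bdd_above (polygon_lengths \<gamma> a b)"
  using polygon_lengths_mono bdd_above_mono by metis

section \<open>Variation and its additivity\<close>

lemma polygon_length_le_variation:
  assumes "bdd_above (polygon_lengths \<gamma> a b)" "sorted ts" "set ts \<subseteq> {a..b}"
  shows "polygon_length \<gamma> ts \<le> variation \<gamma> a b"
  unfolding variation_def by (rule cSup_upper[OF _ assms(1)]) (use assms in \<open>auto simp: polygon_lengths_eq\<close>)

lemma variation_leI:
  assumes "\<And>ts. sorted ts \<Longrightarrow> set ts \<subseteq> {a..b} \<Longrightarrow> polygon_length \<gamma> ts \<le> B"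
  shows "variation \<gamma> a b \<le> B"
  unfolding variation_def
  by (rule cSup_least) (use assms polygon_lengths_nonempty[of \<gamma> a b] in \<open>auto simp: polygon_lengths_eq\<close>)

lemma variation_ge_dist:
  "bdd_above (polygon_lengths \<gamma> a b) \<Longrightarrow> a \<le> b \<Longrightarrow> dist (\<gamma> a) (\<gamma> b) \<le> variation \<gamma> a b"
  using polygon_length_le_variation[of \<gamma> a b "[a, b]"] by simp

text \<open>The cut is made at the first point beyond \<open>u\<close>, so that all copies of
  \<open>u\<close> fall into the first part and the second lies strictly to the right.\<close>

lemma polygon_length_split_le:
  assumes "sorted ts" "set ts \<subseteq> {a..b}" "a \<le> u"
  obtains xs ys where "ts = xs @ ys" "sorted (xs @ [u])" "sorted (u # ys)"
    "set (xs @ [u]) \<subseteq> {a..u}" "set ys \<subseteq> {u<..b}"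
proof
  let ?xs = "takeWhile (\<lambda>t. t \<le> u) ts" and ?ys = "dropWhile (\<lambda>t. t \<le> u) ts"
  show ts: "ts = ?xs @ ?ys" by simp
  have s: "sorted ?xs" "sorted ?ys"
    using assms(1) sorted_wrt_append[of "(\<le>)" ?xs ?ys] by simp_all
  have xs: "t \<le> u" "a \<le> t" if "t \<in> set ?xs" for t
    using set_takeWhileD[OF that] assms(2) by auto
  have ys: "u < t" if t: "t \<in> set ?ys" for t
  proof -
    have ne: "?ys \<noteq> []" using t by (metis empty_iff list.set(1))
    hence "\<not> hd ?ys \<le> u" by (rule hd_dropWhile)
    moreover have "hd ?ys \<le> t" using s(2) t ne by (cases ?ys) auto
    ultimately show ?thesis by simp
  qed
  show "sorted (?xs @ [u])" using s(1) xs by (simp add: sorted_append)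
  show "sorted (u # ?ys)" using s(2) ys by (simp add: less_imp_le)
  show "set (?xs @ [u]) \<subseteq> {a..u}" using xs assms(3) by auto
  show "set ?ys \<subseteq> {u<..b}"
  proof
    fix t assume "t \<in> set ?ys"
    with ys[OF this] set_dropWhileD[OF this] assms(2) show "t \<in> {u<..b}" by auto
  qed
qed

text \<open>Inserting \<open>b\<close> into a partition of the whole interval gives one inequality.
  Concatenating partitions of the two pieces gives the other, by taking the supremum first over
  \<open>ys\<close> and then over \<open>xs\<close>.\<close>

lemma variation_add:
  assumes bdd: "bdd_above (polygon_lengths \<gamma> a c)" and ab: "a \<le> b" and bc: "b \<le> c"
  shows "variation \<gamma> a c = variation \<gamma> a b + variation \<gamma> b c"
proof (rule antisym)
  note bdds = bdd_above_polygon_lengths_mono[OF bdd, of a b] bdd_above_polygon_lengths_mono[OF bdd, of b c]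
  show "variation \<gamma> a c \<le> variation \<gamma> a b + variation \<gamma> b c"
  proof (rule variation_leI)
    fix ts assume ts: "sorted ts" "set ts \<subseteq> {a..c}"
    obtain xs ys where *: "ts = xs @ ys" "sorted (xs @ [b])" "sorted (b # ys)"
      "set (xs @ [b]) \<subseteq> {a..b}" "set ys \<subseteq> {b<..c}"
      using polygon_length_split_le[OF ts ab] .
    have "polygon_length \<gamma> ts \<le> polygon_length \<gamma> (xs @ [b]) + polygon_length \<gamma> (b # ys)"
      unfolding *(1) by (rule polygon_length_insert)
    also have "\<dots> \<le> variation \<gamma> a b + variation \<gamma> b c"
      using * ab bc bdds by (intro add_mono polygon_length_le_variation) auto
    finally show "polygon_length \<gamma> ts \<le> variation \<gamma> a b + variation \<gamma> b c" .
  qed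
  have "variation \<gamma> a b \<le> variation \<gamma> a c - variation \<gamma> b c"
  proof (rule variation_leI)
    fix xs assume xs: "sorted xs" "set xs \<subseteq> {a..b}"
    have "variation \<gamma> b c \<le> variation \<gamma> a c - polygon_length \<gamma> xs"
    proof (rule variation_leI)
      fix ys assume ys: "sorted ys" "set ys \<subseteq> {b..c}"
      have "sorted (xs @ ys)" using xs ys by (fastforce simp: sorted_append)
      moreover have "set (xs @ ys) \<subseteq> {a..c}" using xs ys ab bc by fastforce
      ultimately have "polygon_length \<gamma> (xs @ ys) \<le> variation \<gamma> a c"
        by (intro polygon_length_le_variation bdd)
      thus "polygon_length \<gamma> ys \<le> variation \<gamma> a c - polygon_length \<gamma> xs"
        using polygon_length_append_ge[of \<gamma> xs ys] by simp
    qed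
    thus "polygon_length \<gamma> xs \<le> variation \<gamma> a c - variation \<gamma> b c" by simp
  qed
  thus "variation \<gamma> a b + variation \<gamma> b c \<le> variation \<gamma> a c" by simp
qed

section \<open>Continuity of arc length\<close>

lemma variation_nonneg: "bdd_above (polygon_lengths \<gamma> a b) \<Longrightarrow> 0 \<le> variation \<gamma> a b"
  using polygon_length_le_variation[of \<gamma> a b "[]"] by simp

text \<open>Repetitions of \<open>a\<close> contribute nothing, which leaves at most the last
  edge.\<close>

lemma polygon_length_replicate_le:
  "set xs \<subseteq> {a} \<Longrightarrow> polygon_length \<gamma> (xs @ [u]) \<le> dist (\<gamma> a) (\<gamma> u)"
  by (induction xs rule: induct_list012) auto

text \<open>Take a nearly optimal partition; a point \<open>u\<close> close to \<open>a\<close> and below all its other points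
  can be inserted at the cost of the small distance from \<open>\<gamma> a\<close> to \<open>\<gamma> u\<close> only.\<close>

lemma variation_right_small:
  assumes bdd: "bdd_above (polygon_lengths \<gamma> a b)" and ab: "a < b"
    and cont: "continuous_on {a..b} \<gamma>" and e: "e > 0"
  obtains u where "a < u" "u \<le> b" "variation \<gamma> a u < e"
proof -
  have "\<exists>l\<in>polygon_lengths \<gamma> a b. variation \<gamma> a b - e / 2 < l"
    using polygon_lengths_nonempty[of \<gamma> a b] bdd e
    by (subst less_cSup_iff[symmetric]) (auto simp: variation_def)
  then obtain ts where ts: "sorted ts" "set ts \<subseteq> {a..b}" and near: "variation \<gamma> a b - e / 2 < polygon_length \<gamma> ts"
    by (auto simp: polygon_lengths_eq)
  \<comment> \<open>Inserting \<open>b\<close> keeps the set nonempty when no partition point lies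
    beyond \<open>a\<close>.\<close>
  define m where "m = Min (insert b {t \<in> set ts. a < t})"
  have m: "a < m" "m \<le> b" "\<And>t. t \<in> set ts \<Longrightarrow> a < t \<Longrightarrow> m \<le> t" using ab by (auto simp: m_def)
  obtain d where d: "d > 0" "\<And>t. t \<in> {a..b} \<Longrightarrow> dist t a < d \<Longrightarrow> dist (\<gamma> t) (\<gamma> a) < e / 2"
    using cont e ab unfolding continuous_on_iff by (metis atLeastAtMost_iff half_gt_zero less_imp_le order_refl)
  \<comment> \<open>The midpoint lies below both \<open>m\<close> and \<open>a + d\<close>:
    partition points up to \<open>u\<close> can only be copies of \<open>a\<close>, and
    \<open>\<gamma> u\<close> is within \<open>e / 2\<close> of \<open>\<gamma> a\<close>.\<close>
  define u where "u = (a + min m (a + d)) / 2"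
  have u: "a < u" "u < m" "u < a + d" using m(1) d(1) by (auto simp: u_def min_def field_simps)
  obtain xs ys where *: "ts = xs @ ys" "sorted (xs @ [u])" "sorted (u # ys)"
      "set (xs @ [u]) \<subseteq> {a..u}" "set ys \<subseteq> {u<..b}"
    using polygon_length_split_le[OF ts, of u] u by auto
  have "set xs \<subseteq> {a}"
  proof
    fix t assume t: "t \<in> set xs"
    hence "a \<le> t" "t \<le> u" using *(4) by auto
    thus "t \<in> {a}" using m(3)[of t] t *(1) u by force
  qed
  hence "polygon_length \<gamma> (xs @ [u]) \<le> dist (\<gamma> a) (\<gamma> u)" by (rule polygon_length_replicate_le)
  also have "\<dots> < e / 2" using d(2)[of u] u m by (simp add: dist_commute dist_real_def)
  finally have "polygon_length \<gamma> (xs @ [u]) < e / 2" .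
  moreover have "polygon_length \<gamma> (u # ys) \<le> variation \<gamma> u b"
    using *(3,5) u m by (intro polygon_length_le_variation bdd_above_polygon_lengths_mono[OF bdd]) auto
  ultimately have "variation \<gamma> a b < e + variation \<gamma> u b"
    using near polygon_length_insert[of \<gamma> xs ys u] unfolding *(1) by simp
  moreover have "variation \<gamma> a b = variation \<gamma> a u + variation \<gamma> u b"
    using u m by (intro variation_add bdd) auto
  ultimately have "variation \<gamma> a u < e" by simp
  thus thesis using that u m by (meson less_imp_le order_less_le_trans)
qed

text \<open>Reflection of the parameter reduces this to
  \<open>variation_right_small\<close>.\<close>

lemma variation_left_small:
  assumes bdd: "bdd_above (polygon_lengths \<gamma> a b)" and ab: "a < b"
    and cont: "continuous_on {a..b} \<gamma>" and e: "e > 0"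
  obtains u where "a \<le> u" "u < b" "variation \<gamma> u b < e"
proof -
  \<comment> \<open>Writing \<open>0 - t\<close> makes this an instance of
    \<open>polygon_lengths_reflect\<close>.\<close>
  have "continuous_on {- b..- a} (\<lambda>t. \<gamma> (0 - t))"
    by (rule continuous_on_compose2[OF cont]) (auto intro!: continuous_intros)
  then obtain u where "- b < u" "u \<le> - a" "variation (\<lambda>t. \<gamma> (0 - t)) (- b) u < e"
    using variation_right_small[of "\<lambda>t. \<gamma> (0 - t)" "- b" "- a" e] bdd ab e
    by (auto simp only: polygon_lengths_reflect) auto
  thus thesis using that[of "- u"] unfolding variation_def polygon_lengths_reflect by simp
qed

text \<open>Arc length extended by constants: the distribution function of the measure in
  \<open>arc_integral\<close>.\<close>

definition arc_distribution :: "(real \<Rightarrow> complex) \<Rightarrow> real \<Rightarrow> real" where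
  "arc_distribution \<gamma> t = arc_length \<gamma> (max 0 (min t 1))"

lemma rectifiable_pathD:
  assumes "rectifiable_path \<gamma>"
  shows "path \<gamma>" "continuous_on {0..1} \<gamma>" "0 \<le> a \<Longrightarrow> b \<le> 1 \<Longrightarrow> bdd_above (polygon_lengths \<gamma> a b)"
  using assms bdd_above_polygon_lengths_mono[of \<gamma> 0 1 a b] unfolding rectifiable_path_def path_def by simp_all

lemma variation_diff:
  assumes "rectifiable_path \<gamma>" "0 \<le> s" "s \<le> t" "t \<le> 1"
  shows "variation \<gamma> 0 t - variation \<gamma> 0 s = variation \<gamma> s t"
  using variation_add[of \<gamma> 0 t s] rectifiable_pathD(3)[OF assms(1)] assms by simp

lemma arc_distribution_mono:
  assumes "rectifiable_path \<gamma>" "s \<le> t"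
  shows "arc_distribution \<gamma> s \<le> arc_distribution \<gamma> t"
proof -
  have "variation \<gamma> 0 y - variation \<gamma> 0 x \<ge> 0" if "0 \<le> x" "x \<le> y" "y \<le> 1" for x y
    using variation_diff[OF assms(1) that] variation_nonneg[OF rectifiable_pathD(3)[OF assms(1)]] that by simp
  from this[of "max 0 (min s 1)" "max 0 (min t 1)"] assms(2)
  show ?thesis unfolding arc_distribution_def arc_length_eq_variation by (simp add: min_def max_def)
qed

text \<open>By additivity, increments are variations over short intervals. These are small on both
  sides of a point by \<open>variation_right_small\<close> and \<open>variation_left_small\<close>,
  and shrinking the interval keeps them small.\<close>

lemma variation_continuous:
  assumes \<gamma>: "rectifiable_path \<gamma>"
  shows "continuous_on {0..1} (variation \<gamma> 0)"
  unfolding continuous_on_iff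
proof (intro ballI allI impI)
  fix s e :: real assume s: "s \<in> {0..1}" and e: "e > 0"
  note bdd = rectifiable_pathD(3)[OF \<gamma>]
  have mono: "variation \<gamma> x y \<le> variation \<gamma> x' y'" if "0 \<le> x'" "x' \<le> x" "x \<le> y" "y \<le> y'" "y' \<le> 1" for x y x' y'
    using that variation_add[of \<gamma> x' y' x] variation_add[of \<gamma> x y' y] bdd
      variation_nonneg[of \<gamma> x' x] variation_nonneg[of \<gamma> y y'] by simp
  obtain r where r: "r > s" "\<And>t. s \<le> t \<Longrightarrow> t < r \<Longrightarrow> t \<le> 1 \<Longrightarrow> variation \<gamma> s t < e"
  proof (cases "s = 1")
    case True
    \<comment> \<open>No parameter exceeds 1, so any number above 1 will do for \<open>r\<close>.
      The variation over the degenerate interval is a difference of equal terms, hence 0.\<close>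
    show thesis
    proof (rule that[of 2])
      fix t assume t: "s \<le> t" "t < 2" "t \<le> 1"
      thus "variation \<gamma> s t < e" using True e variation_diff[OF \<gamma>, of 1 1] by simp
    qed (use True in auto)
  next
    case False
    obtain u where u: "s < u" "u \<le> 1" "variation \<gamma> s u < e"
      by (rule variation_right_small[of \<gamma> s 1 e])
        (use s False e bdd rectifiable_pathD(2)[OF \<gamma>] in \<open>auto intro: continuous_on_subset\<close>)
    show thesis
    proof (rule that[OF u(1)])
      fix t assume "s \<le> t" "t < u"
      thus "variation \<gamma> s t < e" using mono[of s s t u] u s by simp
    qed
  qed
  obtain l where l: "l < s" "\<And>t. t \<le> s \<Longrightarrow> l < t \<Longrightarrow> 0 \<le> t \<Longrightarrow> variation \<gamma> t s < e"
  proof (cases "s = 0")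
    case True
    show thesis
    proof (rule that[of "-1"])
      fix t assume t: "t \<le> s" "-1 < t" "0 \<le> t"
      thus "variation \<gamma> t s < e" using True e variation_diff[OF \<gamma>, of 0 0] by simp
    qed (use True in auto)
  next
    case False
    obtain u where u: "0 \<le> u" "u < s" "variation \<gamma> u s < e"
      by (rule variation_left_small[of \<gamma> 0 s e])
        (use s False e bdd rectifiable_pathD(2)[OF \<gamma>] in \<open>auto intro: continuous_on_subset\<close>)
    show thesis
    proof (rule that[OF u(2)])
      fix t assume "t \<le> s" "u < t"
      thus "variation \<gamma> t s < e" using mono[of u t s s] u s by simp
    qed
  qed
  have "dist (variation \<gamma> 0 t) (variation \<gamma> 0 s) < e" if t: "t \<in> {0..1}" "dist t s < min (r - s) (s - l)" for t
  proof (cases "s \<le> t")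
    case True
    have "variation \<gamma> s t < e" using r(2)[of t] t True by (auto simp: dist_real_def)
    thus ?thesis using variation_diff[OF \<gamma>, of s t] variation_nonneg[of \<gamma> s t] bdd[of s t] s t True
      by (auto simp: dist_real_def)
  next
    case False
    have "variation \<gamma> t s < e" using l(2)[of t] t False by (auto simp: dist_real_def)
    thus ?thesis using variation_diff[OF \<gamma>, of t s] variation_nonneg[of \<gamma> t s] bdd[of t s] s t False
      by (auto simp: dist_real_def)
  qed
  thus "\<exists>d>0. \<forall>t\<in>{0..1}. dist t s < d \<longrightarrow> dist (variation \<gamma> 0 t) (variation \<gamma> 0 s) < e"
    using r(1) l(1) by (intro exI[of _ "min (r - s) (s - l)"]) auto
qed

lemma arc_distribution_continuous:
  assumes "rectifiable_path \<gamma>"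
  shows "continuous_on UNIV (arc_distribution \<gamma>)"
  unfolding arc_distribution_def arc_length_eq_variation
  by (rule continuous_on_compose2[OF variation_continuous[OF assms]]) (auto intro!: continuous_intros)

lemma arc_distribution_diff:
  assumes "rectifiable_path \<gamma>" "0 \<le> s" "s \<le> t" "t \<le> 1"
  shows "arc_distribution \<gamma> t - arc_distribution \<gamma> s = variation \<gamma> s t"
  using variation_diff[OF assms] assms by (simp add: arc_distribution_def arc_length_eq_variation)

section \<open>Arc length under reversal and concatenation, and of segments\<close>

lemma rectifiable_reversepath:
  assumes "rectifiable_path \<gamma>"
  shows "rectifiable_path (reversepath \<gamma>)"
    and "arc_distribution (reversepath \<gamma>) t = arc_distribution \<gamma> 1 - arc_distribution \<gamma> (1 - t)"
proof -
  have eq: "polygon_lengths (reversepath \<gamma>) a b = polygon_lengths \<gamma> (1 - b) (1 - a)" for a b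
    unfolding reversepath_def by (rule polygon_lengths_reflect)
  show "rectifiable_path (reversepath \<gamma>)"
    using assms eq[of 0 1] by (simp add: rectifiable_path_def)
  define u where "u = max 0 (min t 1)"
  have u: "max 0 (min (1 - t) 1) = 1 - u" by (auto simp: u_def)
  have "variation (reversepath \<gamma>) 0 u = variation \<gamma> (1 - u) 1" by (simp add: variation_def eq)
  also have "\<dots> = variation \<gamma> 0 1 - variation \<gamma> 0 (1 - u)"
    by (rule variation_diff[OF assms, symmetric]) (auto simp: u_def)
  finally show "arc_distribution (reversepath \<gamma>) t = arc_distribution \<gamma> 1 - arc_distribution \<gamma> (1 - t)"
    unfolding arc_distribution_def arc_length_eq_variation u by (simp add: u_def)
qed

text \<open>Each half of the concatenation is an affine reparametrization of one of the paths. A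
  single formula covers all \<open>t\<close> because \<open>arc_distribution\<close> is constant on
  either side of the unit interval, with value 0 on the left.\<close>

lemma rectifiable_joinpaths:
  assumes \<gamma>: "rectifiable_path \<gamma>" and \<delta>: "rectifiable_path \<delta>" and ends: "pathfinish \<gamma> = pathstart \<delta>"
  shows "rectifiable_path (\<gamma> +++ \<delta>)"
    and "arc_distribution (\<gamma> +++ \<delta>) t = arc_distribution \<gamma> (2 * t) + arc_distribution \<delta> (2 * t - 1)"
proof -
  have eq1: "polygon_lengths (\<gamma> +++ \<delta>) a b = polygon_lengths \<gamma> (2 * a) (2 * b)" if "b \<le> 1/2" for a b
  proof -
    have "polygon_lengths (\<gamma> +++ \<delta>) a b = polygon_lengths (\<lambda>t. \<gamma> (2 * t + 0)) a b"
      by (rule polygon_lengths_cong) (use that in \<open>auto simp: joinpaths_def\<close>)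
    thus ?thesis by (subst (asm) polygon_lengths_affine) auto
  qed
  have eq2: "polygon_lengths (\<gamma> +++ \<delta>) a b = polygon_lengths \<delta> (2 * a - 1) (2 * b - 1)" if a: "1/2 \<le> a" for a b
  proof -
    have "polygon_lengths (\<gamma> +++ \<delta>) a b = polygon_lengths (\<lambda>t. \<delta> (2 * t + (-1))) a b"
    proof (rule polygon_lengths_cong)
      fix t assume "t \<in> {a..b}"
      \<comment> \<open>At 1/2 the concatenation is defined through \<open>\<gamma>\<close>, so the
        coincidence of the endpoints enters here.\<close>
      then consider "t = 1/2" | "t > 1/2" using a by fastforce
      thus "(\<gamma> +++ \<delta>) t = \<delta> (2 * t + (-1))"
      proof cases
        case 1 show ?thesis using ends unfolding 1 by (simp add: joinpaths_def pathfinish_def pathstart_def)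
      qed (simp add: joinpaths_def)
    qed
    thus ?thesis by (subst (asm) polygon_lengths_affine) auto
  qed
  have b1: "bdd_above (polygon_lengths (\<gamma> +++ \<delta>) 0 (1/2))" and b2: "bdd_above (polygon_lengths (\<gamma> +++ \<delta>) (1/2) 1)"
    using rectifiable_pathD(3)[OF \<gamma>] rectifiable_pathD(3)[OF \<delta>] by (simp_all add: eq1 eq2)
  have "polygon_length (\<gamma> +++ \<delta>) ts \<le> variation (\<gamma> +++ \<delta>) 0 (1/2) + variation (\<gamma> +++ \<delta>) (1/2) 1"
    if ts: "sorted ts" "set ts \<subseteq> {0..1}" for ts
  proof -
    obtain xs ys where *: "ts = xs @ ys" "sorted (xs @ [1/2])" "sorted (1/2 # ys)"
      "set (xs @ [1/2]) \<subseteq> {0..1/2}" "set ys \<subseteq> {1/2<..1}"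
      by (rule polygon_length_split_le[OF ts, of "1/2"]) auto
    have "polygon_length (\<gamma> +++ \<delta>) ts \<le> polygon_length (\<gamma> +++ \<delta>) (xs @ [1/2]) + polygon_length (\<gamma> +++ \<delta>) (1/2 # ys)"
      unfolding *(1) by (rule polygon_length_insert)
    also have "\<dots> \<le> variation (\<gamma> +++ \<delta>) 0 (1/2) + variation (\<gamma> +++ \<delta>) (1/2) 1"
      using * b1 b2 by (intro add_mono polygon_length_le_variation) auto
    finally show ?thesis .
  qed
  hence "bdd_above (polygon_lengths (\<gamma> +++ \<delta>) 0 1)"
    unfolding polygon_lengths_eq bdd_above_def by blast
  thus join: "rectifiable_path (\<gamma> +++ \<delta>)"
    using \<gamma> \<delta> ends by (simp add: rectifiable_path_def)
  have v0: "variation \<alpha> 0 0 = 0" if "rectifiable_path \<alpha>" for \<alpha>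
    using variation_diff[OF that, of 0 0] by simp
  define u where "u = max 0 (min t 1)"
  have dist_u: "arc_distribution (\<gamma> +++ \<delta>) t = variation (\<gamma> +++ \<delta>) 0 u"
    by (simp add: arc_distribution_def arc_length_eq_variation u_def)
  show "arc_distribution (\<gamma> +++ \<delta>) t = arc_distribution \<gamma> (2 * t) + arc_distribution \<delta> (2 * t - 1)"
  proof (cases "t \<le> 1/2")
    case True
    have "variation (\<gamma> +++ \<delta>) 0 u = variation \<gamma> 0 (2 * u)" using True by (simp add: variation_def eq1 u_def)
    moreover have "max 0 (min (2 * t) 1) = 2 * u" "max 0 (min (2 * t - 1) 1) = 0" using True by (auto simp: u_def)
    ultimately show ?thesis using v0[OF \<delta>] dist_u by (simp add: arc_distribution_def arc_length_eq_variation)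
  next
    case False
    have "variation (\<gamma> +++ \<delta>) 0 u = variation (\<gamma> +++ \<delta>) 0 (1/2) + variation (\<gamma> +++ \<delta>) (1/2) u"
      using False rectifiable_pathD(3)[OF join] by (intro variation_add) (auto simp: u_def)
    also have "\<dots> = variation \<gamma> 0 1 + variation \<delta> 0 (2 * u - 1)" by (simp add: variation_def eq1 eq2)
    finally have "variation (\<gamma> +++ \<delta>) 0 u = variation \<gamma> 0 1 + variation \<delta> 0 (2 * u - 1)" .
    moreover have "max 0 (min (2 * t) 1) = 1" "max 0 (min (2 * t - 1) 1) = 2 * u - 1" using False by (auto simp: u_def)
    ultimately show ?thesis using dist_u by (simp add: arc_distribution_def arc_length_eq_variation)
  qed
qed

text \<open>Edge lengths of an inscribed polygon are proportional to the parameter increments, which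
  telescope.\<close>

lemma rectifiable_linepath:
  shows "rectifiable_path (linepath x y)" "variation (linepath x y) 0 1 \<le> dist x y"
proof -
  have tele: "polygon_length (linepath x y) (t # ts) = dist x y * (last (t # ts) - t)" if "sorted (t # ts)" for t ts
    using that
  proof (induction ts arbitrary: t)
    case (Cons u ts)
    have "linepath x y t - linepath x y u = (u - t) *\<^sub>R (x - y)"
      by (simp add: linepath_def scaleR_conv_of_real algebra_simps)
    hence "dist (linepath x y t) (linepath x y u) = (u - t) * dist x y"
      using Cons.prems by (simp add: dist_norm)
    thus ?case using Cons.IH[of u] Cons.prems by (simp add: algebra_simps)
  qed simp
  have le: "polygon_length (linepath x y) ts \<le> dist x y" if "sorted ts" "set ts \<subseteq> {0..1}" for ts
  proof (cases ts)
    case (Cons t us)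
    have "last ts \<in> {0..1}" "t \<in> {0..1}" using that(2) Cons last_in_set[of ts] by auto
    hence "dist x y * (last ts - t) \<le> dist x y * 1" by (intro mult_left_mono) auto
    thus ?thesis using tele[of t us] that Cons by simp
  qed simp
  thus "rectifiable_path (linepath x y)"
    unfolding rectifiable_path_def polygon_lengths_eq bdd_above_def by blast
  show "variation (linepath x y) 0 1 \<le> dist x y" by (rule variation_leI) (rule le)
qed

subsection \<open>Integration along rectifiable paths\<close>

text \<open>Half-open intervals form an intersection-stable generator of the Borel sets, and
  countably many of them, of finite measure, cover the line.\<close>

lemma measure_eqI_Ioc:
  fixes M N :: "real measure"
  assumes sets: "sets M = sets borel" "sets N = sets borel"
    and eq: "\<And>a b. a \<le> b \<Longrightarrow> emeasure M {a<..b} = emeasure N {a<..b}"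
    and fin: "\<And>a b. a \<le> b \<Longrightarrow> emeasure M {a<..b} \<noteq> \<infinity>"
  shows "M = N"
proof (rule measure_eqI_generator_eq[where \<Omega> = UNIV and E = "range (\<lambda>(a, b). {a<..b::real})"])
  fix X assume "X \<in> range (\<lambda>(a, b). {a<..b::real})"
  then obtain a b where X: "X = {a<..b}" by auto
  show "emeasure M X = emeasure N X" using eq[of a b] X by (cases "a \<le> b") auto
next
  show "(\<Union>i. {- real (i::nat)<..real i}) = UNIV"
  proof (intro set_eqI iffI UNIV_I)
    fix x :: real
    obtain n where "\<bar>x\<bar> < real n" using reals_Archimedean2 by blast
    thus "x \<in> (\<Union>i. {- real (i::nat)<..real i})" by (intro UN_I[of n]) auto
  qed
qed (use sets fin in \<open>auto simp: borel_sigma_sets_Ioc Int_stable_def\<close>)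

section \<open>The arc length measure and its integrals\<close>

definition arc_measure :: "(real \<Rightarrow> complex) \<Rightarrow> real measure" where
  "arc_measure \<gamma> = interval_measure (arc_distribution \<gamma>)"

lemma sets_arc_measure [simp, measurable_cong]: "sets (arc_measure \<gamma>) = sets borel"
  and space_arc_measure [simp]: "space (arc_measure \<gamma>) = UNIV"
  by (simp_all add: arc_measure_def)

lemma arc_integral_eq:
  "arc_integral \<rho> \<gamma> = (\<integral>\<^sup>+t. ennreal (\<rho> (\<gamma> t)) * indicator {0..1} t \<partial>arc_measure \<gamma>)"
  by (simp add: arc_integral_def arc_measure_def arc_distribution_def[abs_def])

text \<open>Continuity of the distribution function excludes atoms, so endpoints do not matter.
  Intervals \<open>{a..<b}\<close> arise when a path is reversed.\<close>

lemma emeasure_arc_measure: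
  assumes "rectifiable_path \<gamma>" "a \<le> b"
  shows "emeasure (arc_measure \<gamma>) {a..b} = ennreal (arc_distribution \<gamma> b - arc_distribution \<gamma> a)"
    and "emeasure (arc_measure \<gamma>) {a<..b} = ennreal (arc_distribution \<gamma> b - arc_distribution \<gamma> a)"
    and "emeasure (arc_measure \<gamma>) {a..<b} = ennreal (arc_distribution \<gamma> b - arc_distribution \<gamma> a)"
proof -
  have Icc: "emeasure (arc_measure \<gamma>) {a..b} = ennreal (arc_distribution \<gamma> b - arc_distribution \<gamma> a)" if "a \<le> b" for a b
    unfolding arc_measure_def
    by (rule emeasure_interval_measure_Icc[OF that arc_distribution_mono arc_distribution_continuous]) (use assms in auto)
  have null: "{t} \<in> null_sets (arc_measure \<gamma>)" for t
    using Icc[of t t] by (simp add: null_sets_def)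
  show *: "emeasure (arc_measure \<gamma>) {a..b} = ennreal (arc_distribution \<gamma> b - arc_distribution \<gamma> a)"
    by (rule Icc[OF assms(2)])
  have "{a..b} - {a} = {a<..b}" "{a..b} - {b} = {a..<b}" by auto
  note diff = this
  show "emeasure (arc_measure \<gamma>) {a<..b} = ennreal (arc_distribution \<gamma> b - arc_distribution \<gamma> a)"
    using emeasure_Diff_null_set[OF null[of a], of "{a..b}"] * by (simp add: diff)
  show "emeasure (arc_measure \<gamma>) {a..<b} = ennreal (arc_distribution \<gamma> b - arc_distribution \<gamma> a)"
    using emeasure_Diff_null_set[OF null[of b], of "{a..b}"] * by (simp add: diff)
qed

lemma arc_measure_reversepath:
  assumes "rectifiable_path \<gamma>"
  shows "arc_measure (reversepath \<gamma>) = distr (arc_measure \<gamma>) borel (\<lambda>t. 1 - t)"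
proof (rule measure_eqI_Ioc)
  fix a b :: real assume "a \<le> b"
  have "(\<lambda>t. 1 - t) -` {a<..b} = {1 - b..<1 - a}" by auto
  thus "emeasure (arc_measure (reversepath \<gamma>)) {a<..b} = emeasure (distr (arc_measure \<gamma>) borel (\<lambda>t. 1 - t)) {a<..b}"
    using \<open>a \<le> b\<close> rectifiable_reversepath[OF assms]
    by (simp add: emeasure_distr emeasure_arc_measure assms)
qed (use emeasure_arc_measure rectifiable_reversepath[OF assms] in auto)

text \<open>Cut at 1/2, the measure of the concatenation falls into the images of the two given
  measures. Restriction is expressed by a density so that integrals transform by
  \<open>nn_integral_density\<close>.\<close>

lemma arc_measure_joinpaths:
  assumes "rectifiable_path \<gamma>" "rectifiable_path \<delta>" "pathfinish \<gamma> = pathstart \<delta>"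
  shows "density (arc_measure (\<gamma> +++ \<delta>)) (indicator {..1/2}) = distr (arc_measure \<gamma>) borel (\<lambda>t. t / 2)"
    and "density (arc_measure (\<gamma> +++ \<delta>)) (indicator {1/2<..}) = distr (arc_measure \<delta>) borel (\<lambda>t. (t + 1) / 2)"
proof -
  note J = rectifiable_joinpaths[OF assms]
  have c1: "arc_distribution \<gamma> t = arc_distribution \<gamma> 1" if "t \<ge> 1" for t
    using that by (simp add: arc_distribution_def)
  have c0: "arc_distribution \<delta> t = arc_distribution \<delta> 0" if "t \<le> 0" for t
    using that by (simp add: arc_distribution_def)
  have density: "emeasure (density (arc_measure (\<gamma> +++ \<delta>)) (indicator A)) B = emeasure (arc_measure (\<gamma> +++ \<delta>)) (A \<inter> B)"
    if "A \<in> sets borel" "B \<in> sets borel" for A B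
    using that by (simp add: emeasure_density flip: indicator_inter_arith)
  \<comment> \<open>On either side of 1/2 the other path contributes a constant, which cancels in
    the interval measures.\<close>
  have Jl: "arc_distribution (\<gamma> +++ \<delta>) t = arc_distribution \<gamma> (2 * t) + arc_distribution \<delta> 0"
    if "t \<le> 1/2" for t using J(2) c0[of "2 * t - 1"] that by simp
  have Jr: "arc_distribution (\<gamma> +++ \<delta>) t = arc_distribution \<gamma> 1 + arc_distribution \<delta> (2 * t - 1)"
    if "1/2 \<le> t" for t using J(2) c1[of "2 * t"] that by simp
  have eq1: "emeasure (density (arc_measure (\<gamma> +++ \<delta>)) (indicator {..1/2})) {a<..b} =
      ennreal (arc_distribution \<gamma> (2 * b) - arc_distribution \<gamma> (2 * a))" if "a \<le> b" for a b
  proof (cases "a \<le> 1/2")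
    case True
    have "{..1/2} \<inter> {a<..b} = {a<..min b (1/2)}" by auto
    hence "emeasure (density (arc_measure (\<gamma> +++ \<delta>)) (indicator {..1/2})) {a<..b} =
        ennreal (arc_distribution (\<gamma> +++ \<delta>) (min b (1/2)) - arc_distribution (\<gamma> +++ \<delta>) a)"
      using emeasure_arc_measure(2)[OF J(1), of a "min b (1/2)"] True that by (simp add: density)
    also have "arc_distribution (\<gamma> +++ \<delta>) (min b (1/2)) = arc_distribution \<gamma> (2 * b) + arc_distribution \<delta> 0"
      using Jl[of "min b (1/2)"] c1[of "2 * b"] by (cases "b \<le> 1/2") (auto simp: min_def)
    also have "arc_distribution (\<gamma> +++ \<delta>) a = arc_distribution \<gamma> (2 * a) + arc_distribution \<delta> 0"
      by (rule Jl[OF True])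
    finally show ?thesis by simp
  next
    case False
    hence "{..1/2} \<inter> {a<..b} = {}" by auto
    thus ?thesis using False that c1[of "2 * a"] c1[of "2 * b"] by (simp add: density)
  qed
  have eq2: "emeasure (density (arc_measure (\<gamma> +++ \<delta>)) (indicator {1/2<..})) {a<..b} =
      ennreal (arc_distribution \<delta> (2 * b - 1) - arc_distribution \<delta> (2 * a - 1))" if "a \<le> b" for a b
  proof (cases "1/2 \<le> b")
    case True
    have "{1/2<..} \<inter> {a<..b} = {max a (1/2)<..b}" by auto
    moreover have "max a (1/2) \<le> b" using True that by simp
    ultimately have "emeasure (density (arc_measure (\<gamma> +++ \<delta>)) (indicator {1/2<..})) {a<..b} =
        ennreal (arc_distribution (\<gamma> +++ \<delta>) b - arc_distribution (\<gamma> +++ \<delta>) (max a (1/2)))"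
      using emeasure_arc_measure(2)[OF J(1)] density[of "{1/2<..}" "{a<..b}"] by simp
    also have "arc_distribution (\<gamma> +++ \<delta>) (max a (1/2)) = arc_distribution \<gamma> 1 + arc_distribution \<delta> (2 * a - 1)"
      using Jr[of "max a (1/2)"] c0[of "2 * a - 1"] by (cases "1/2 \<le> a") (auto simp: max_def)
    also have "arc_distribution (\<gamma> +++ \<delta>) b = arc_distribution \<gamma> 1 + arc_distribution \<delta> (2 * b - 1)"
      by (rule Jr[OF True])
    finally show ?thesis by simp
  next
    case False
    hence "{1/2<..} \<inter> {a<..b} = {}" by auto
    thus ?thesis using False that c0[of "2 * a - 1"] c0[of "2 * b - 1"] by (simp add: density)
  qed
  show "density (arc_measure (\<gamma> +++ \<delta>)) (indicator {..1/2}) = distr (arc_measure \<gamma>) borel (\<lambda>t. t / 2)"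
  proof (rule measure_eqI_Ioc)
    fix a b :: real assume "a \<le> b"
    have "(\<lambda>t. t / 2) -` {a<..b} = {2 * a<..2 * b}" by auto
    thus "emeasure (density (arc_measure (\<gamma> +++ \<delta>)) (indicator {..1/2})) {a<..b} =
        emeasure (distr (arc_measure \<gamma>) borel (\<lambda>t. t / 2)) {a<..b}"
      using \<open>a \<le> b\<close> assms by (simp add: emeasure_distr emeasure_arc_measure eq1)
  qed (simp_all add: eq1)
  show "density (arc_measure (\<gamma> +++ \<delta>)) (indicator {1/2<..}) = distr (arc_measure \<delta>) borel (\<lambda>t. (t + 1) / 2)"
  proof (rule measure_eqI_Ioc)
    fix a b :: real assume "a \<le> b"
    have "(\<lambda>t. (t + 1) / 2) -` {a<..b} = {2 * a - 1<..2 * b - 1}" by auto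
    thus "emeasure (density (arc_measure (\<gamma> +++ \<delta>)) (indicator {1/2<..})) {a<..b} =
        emeasure (distr (arc_measure \<delta>) borel (\<lambda>t. (t + 1) / 2)) {a<..b}"
      using \<open>a \<le> b\<close> assms by (simp add: emeasure_distr emeasure_arc_measure eq2)
  qed (simp_all add: eq2)
qed

lemma arc_integrand_measurable:
  assumes \<rho>: "(\<lambda>w. if w \<in> \<Omega> then \<rho> w else 0) \<in> borel_measurable borel"
    and "path \<gamma>" "path_image \<gamma> \<subseteq> \<Omega>"
  shows "(\<lambda>t. ennreal (\<rho> (\<gamma> t)) * indicator {0..1} t) \<in> borel_measurable borel"
proof -
  \<comment> \<open>Continuity of \<open>\<gamma>\<close> is known on the unit interval only;
    composition with \<open>clip\<close> gives a function continuous on the line that agrees with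
    \<open>\<gamma>\<close> there.\<close>
  define clip :: "real \<Rightarrow> real" where "clip t = max 0 (min t 1)" for t
  have "continuous_on UNIV (\<lambda>t. \<gamma> (clip t))"
    unfolding clip_def by (rule continuous_on_compose2[OF assms(2)[unfolded path_def]]) (auto intro!: continuous_intros)
  hence [measurable]: "(\<lambda>t. \<gamma> (clip t)) \<in> borel_measurable borel" by (rule borel_measurable_continuous_onI)
  note \<rho>[measurable]
  have "(\<lambda>t. ennreal (if \<gamma> (clip t) \<in> \<Omega> then \<rho> (\<gamma> (clip t)) else 0) * indicator {0..1} t) \<in> borel_measurable borel"
    using measurable_compose[OF _ \<rho>, of "\<lambda>t. \<gamma> (clip t)" borel] by measurable
  moreover have "\<gamma> t \<in> \<Omega>" if "0 \<le> t" "t \<le> 1" for t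
    using assms(3) that by (auto simp: path_image_def)
  hence "(\<lambda>t. ennreal (if \<gamma> (clip t) \<in> \<Omega> then \<rho> (\<gamma> (clip t)) else 0) * indicator {0..1} t) =
      (\<lambda>t. ennreal (\<rho> (\<gamma> t)) * indicator {0..1} t)"
    by (auto simp: clip_def indicator_def fun_eq_iff)
  ultimately show ?thesis by simp
qed

lemma arc_integral_reversepath:
  assumes \<rho>: "(\<lambda>w. if w \<in> \<Omega> then \<rho> w else 0) \<in> borel_measurable borel"
    and \<gamma>: "rectifiable_path \<gamma>" "path_image \<gamma> \<subseteq> \<Omega>"
  shows "arc_integral \<rho> (reversepath \<gamma>) = arc_integral \<rho> \<gamma>"
proof -
  have "arc_integral \<rho> (reversepath \<gamma>) =
      (\<integral>\<^sup>+t. ennreal (\<rho> (reversepath \<gamma> (1 - t))) * indicator {0..1} (1 - t) \<partial>arc_measure \<gamma>)"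
    unfolding arc_integral_eq arc_measure_reversepath[OF \<gamma>(1)]
    by (rule nn_integral_distr)
      (use arc_integrand_measurable[OF \<rho>, of "reversepath \<gamma>"] \<gamma> rectifiable_pathD(1)[OF \<gamma>(1)] in auto)
  also have "\<dots> = arc_integral \<rho> \<gamma>"
    unfolding arc_integral_eq by (intro nn_integral_cong) (auto simp: reversepath_def indicator_def)
  finally show ?thesis .
qed

lemma arc_integral_joinpaths_le:
  assumes \<rho>: "(\<lambda>w. if w \<in> \<Omega> then \<rho> w else 0) \<in> borel_measurable borel"
    and \<gamma>: "rectifiable_path \<gamma>" "path_image \<gamma> \<subseteq> \<Omega>" and \<delta>: "rectifiable_path \<delta>" "path_image \<delta> \<subseteq> \<Omega>"
    and ends: "pathfinish \<gamma> = pathstart \<delta>"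
  shows "arc_integral \<rho> (\<gamma> +++ \<delta>) \<le> arc_integral \<rho> \<gamma> + arc_integral \<rho> \<delta>"
proof -
  let ?J = "arc_measure (\<gamma> +++ \<delta>)"
  define f where "f t = ennreal (\<rho> ((\<gamma> +++ \<delta>) t)) * indicator {0..1} t" for t
  have f[measurable]: "f \<in> borel_measurable borel"
    unfolding f_def
    by (rule arc_integrand_measurable[OF \<rho>])
      (use rectifiable_pathD(1) rectifiable_joinpaths(1)[OF \<gamma>(1) \<delta>(1) ends] path_image_join_subset \<gamma> \<delta> in blast)+
  \<comment> \<open>Indicators are idempotent: one copy becomes the density, the other keeps the
    integrand supported on its half.\<close>
  have "arc_integral \<rho> (\<gamma> +++ \<delta>) = (\<integral>\<^sup>+t. indicator {..1/2} t * (f t * indicator {..1/2} t) +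
      indicator {1/2<..} t * (f t * indicator {1/2<..} t) \<partial>?J)"
    unfolding arc_integral_eq f_def by (intro nn_integral_cong) (auto simp: indicator_def)
  also have "\<dots> = (\<integral>\<^sup>+t. indicator {..1/2} t * (f t * indicator {..1/2} t) \<partial>?J) +
      (\<integral>\<^sup>+t. indicator {1/2<..} t * (f t * indicator {1/2<..} t) \<partial>?J)"
    by (rule nn_integral_add) measurable
  also have "(\<integral>\<^sup>+t. indicator {..1/2} t * (f t * indicator {..1/2} t) \<partial>?J) =
      (\<integral>\<^sup>+t. f t * indicator {..1/2} t \<partial>density ?J (indicator {..1/2}))"
    by (rule nn_integral_density[symmetric]) measurable
  also have "\<dots> = (\<integral>\<^sup>+t. f (t / 2) * indicator {..1/2} (t / 2) \<partial>arc_measure \<gamma>)"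
    unfolding arc_measure_joinpaths(1)[OF \<gamma>(1) \<delta>(1) ends] by (rule nn_integral_distr) measurable
  also have "\<dots> = arc_integral \<rho> \<gamma>"
    unfolding arc_integral_eq f_def by (intro nn_integral_cong) (auto simp: joinpaths_def indicator_def)
  also have "(\<integral>\<^sup>+t. indicator {1/2<..} t * (f t * indicator {1/2<..} t) \<partial>?J) =
      (\<integral>\<^sup>+t. f t * indicator {1/2<..} t \<partial>density ?J (indicator {1/2<..}))"
    by (rule nn_integral_density[symmetric]) measurable
  also have "\<dots> = (\<integral>\<^sup>+t. f ((t + 1) / 2) * indicator {1/2<..} ((t + 1) / 2) \<partial>arc_measure \<delta>)"
    unfolding arc_measure_joinpaths(2)[OF \<gamma>(1) \<delta>(1) ends] by (rule nn_integral_distr) measurable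
  \<comment> \<open>Only an inequality: at \<open>t = 0\<close> the indicator of
    \<open>{1/2<..}\<close> drops the point 1/2. This suffices for the triangle inequality.\<close>
  also have "\<dots> \<le> arc_integral \<rho> \<delta>"
    unfolding arc_integral_eq f_def
    by (intro nn_integral_mono) (auto simp: joinpaths_def indicator_def add_divide_distrib)
  finally show ?thesis by (simp add: add_left_mono)
qed

lemma arc_integral_le:
  assumes "rectifiable_path \<gamma>" "\<And>w. w \<in> path_image \<gamma> \<Longrightarrow> \<rho> w \<le> M" "M \<ge> 0"
  shows "arc_integral \<rho> \<gamma> \<le> ennreal (M * variation \<gamma> 0 1)"
proof -
  have "arc_integral \<rho> \<gamma> \<le> (\<integral>\<^sup>+t. ennreal M * indicator {0..1} t \<partial>arc_measure \<gamma>)"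
    unfolding arc_integral_eq using assms(2)
    by (intro nn_integral_mono) (auto simp: indicator_def path_image_def intro!: ennreal_leI)
  also have "\<dots> = ennreal M * ennreal (variation \<gamma> 0 1)"
    using assms(1) by (simp add: nn_integral_cmult_indicator emeasure_arc_measure arc_distribution_diff)
  finally show ?thesis using assms(3) by (simp add: ennreal_mult')
qed

text \<open>Only the piece of the path up to time \<open>s\<close> is counted, and its arc length is
  at least its chord.\<close>

lemma arc_integral_ge:
  assumes \<gamma>: "rectifiable_path \<gamma>" and s: "0 \<le> s" "s \<le> 1" and m: "m \<ge> 0"
    and ge: "\<And>t. 0 \<le> t \<Longrightarrow> t \<le> s \<Longrightarrow> m \<le> \<rho> (\<gamma> t)"
  shows "ennreal (m * dist (\<gamma> 0) (\<gamma> s)) \<le> arc_integral \<rho> \<gamma>"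
proof -
  have "m * dist (\<gamma> 0) (\<gamma> s) \<le> m * variation \<gamma> 0 s"
    using variation_ge_dist rectifiable_pathD(3)[OF \<gamma>] s m by (intro mult_left_mono) auto
  hence "ennreal (m * dist (\<gamma> 0) (\<gamma> s)) \<le> ennreal (m * variation \<gamma> 0 s)" by (rule ennreal_leI)
  also have "\<dots> = (\<integral>\<^sup>+t. ennreal m * indicator {0..s} t \<partial>arc_measure \<gamma>)"
    using assms by (simp add: nn_integral_cmult_indicator emeasure_arc_measure arc_distribution_diff ennreal_mult')
  also have "\<dots> \<le> arc_integral \<rho> \<gamma>"
    unfolding arc_integral_eq using ge s
    by (intro nn_integral_mono) (auto simp: indicator_def intro!: ennreal_leI)
  finally show ?thesis .
qed

subsection \<open>The Hurwitz distance\<close>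

definition rectifiable_paths :: "complex set \<Rightarrow> complex \<Rightarrow> complex \<Rightarrow> (real \<Rightarrow> complex) set" where
  "rectifiable_paths \<Omega> x y =
     {\<gamma>. rectifiable_path \<gamma> \<and> path_image \<gamma> \<subseteq> \<Omega> \<and> pathstart \<gamma> = x \<and> pathfinish \<gamma> = y}"

text \<open>The infimum before \<open>enn2real\<close>: inequalities are proved at this level, where
  an infinite value is not mistaken for 0.\<close>

definition hurwitz_edist :: "complex set \<Rightarrow> complex \<Rightarrow> complex \<Rightarrow> ennreal" where
  "hurwitz_edist \<Omega> x y = (INF \<gamma>\<in>rectifiable_paths \<Omega> x y. arc_integral (hurwitz_density \<Omega>) \<gamma>)"

lemma hurwitz_dist_eq: "hurwitz_dist \<Omega> x y = enn2real (hurwitz_edist \<Omega> x y)"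
  by (simp add: hurwitz_dist_def hurwitz_edist_def rectifiable_paths_def)

lemma hurwitz_edist_commute:
  assumes "open \<Omega>" "a \<notin> \<Omega>"
  shows "hurwitz_edist \<Omega> x y = hurwitz_edist \<Omega> y x"
proof -
  have "hurwitz_edist \<Omega> x y \<le> hurwitz_edist \<Omega> y x" for x y
    unfolding hurwitz_edist_def
  proof (rule INF_mono)
    fix \<gamma> assume \<gamma>: "\<gamma> \<in> rectifiable_paths \<Omega> y x"
    hence "reversepath \<gamma> \<in> rectifiable_paths \<Omega> x y"
      using rectifiable_reversepath(1) by (auto simp: rectifiable_paths_def)
    moreover have "arc_integral (hurwitz_density \<Omega>) (reversepath \<gamma>) = arc_integral (hurwitz_density \<Omega>) \<gamma>"
      using \<gamma> by (intro arc_integral_reversepath[OF hurwitz_density_measurable[OF assms]])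
        (auto simp: rectifiable_paths_def)
    ultimately show "\<exists>\<delta>\<in>rectifiable_paths \<Omega> x y.
        arc_integral (hurwitz_density \<Omega>) \<delta> \<le> arc_integral (hurwitz_density \<Omega>) \<gamma>" by (metis order_refl)
  qed
  thus ?thesis by (intro antisym)
qed

text \<open>Concatenate two paths whose integrals are each within \<open>e / 2\<close> of the
  infimum.\<close>

lemma hurwitz_edist_triangle:
  assumes "open \<Omega>" "a \<notin> \<Omega>"
  shows "hurwitz_edist \<Omega> x z \<le> hurwitz_edist \<Omega> x y + hurwitz_edist \<Omega> y z"
proof (rule ennreal_le_epsilon)
  fix e :: real assume fin: "hurwitz_edist \<Omega> x y + hurwitz_edist \<Omega> y z < top" and e: "0 < e"
  have "\<exists>\<gamma>\<in>rectifiable_paths \<Omega> u v. arc_integral (hurwitz_density \<Omega>) \<gamma> < hurwitz_edist \<Omega> u v + ennreal (e / 2)"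
    if "hurwitz_edist \<Omega> u v < top" for u v
  proof -
    have "hurwitz_edist \<Omega> u v < hurwitz_edist \<Omega> u v + ennreal (e / 2)"
      using that e by (cases "hurwitz_edist \<Omega> u v") (simp_all flip: ennreal_plus add: ennreal_less_iff)
    thus ?thesis unfolding hurwitz_edist_def INF_less_iff .
  qed
  from this[of x y] this[of y z] obtain \<gamma> \<delta> where
    \<gamma>: "\<gamma> \<in> rectifiable_paths \<Omega> x y" "arc_integral (hurwitz_density \<Omega>) \<gamma> < hurwitz_edist \<Omega> x y + ennreal (e / 2)" and
    \<delta>: "\<delta> \<in> rectifiable_paths \<Omega> y z" "arc_integral (hurwitz_density \<Omega>) \<delta> < hurwitz_edist \<Omega> y z + ennreal (e / 2)"
    using fin by auto
  have "\<gamma> +++ \<delta> \<in> rectifiable_paths \<Omega> x z"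
    using \<gamma>(1) \<delta>(1) rectifiable_joinpaths(1)[of \<gamma> \<delta>] path_image_join_subset[of \<gamma> \<delta>]
    by (auto simp: rectifiable_paths_def)
  hence "hurwitz_edist \<Omega> x z \<le> arc_integral (hurwitz_density \<Omega>) (\<gamma> +++ \<delta>)"
    unfolding hurwitz_edist_def by (rule INF_lower)
  also have "\<dots> \<le> arc_integral (hurwitz_density \<Omega>) \<gamma> + arc_integral (hurwitz_density \<Omega>) \<delta>"
    using \<gamma>(1) \<delta>(1) by (intro arc_integral_joinpaths_le[OF hurwitz_density_measurable[OF assms]])
      (auto simp: rectifiable_paths_def)
  also have "\<dots> \<le> (hurwitz_edist \<Omega> x y + ennreal (e / 2)) + (hurwitz_edist \<Omega> y z + ennreal (e / 2))"
    using \<gamma>(2) \<delta>(2) by (intro add_mono less_imp_le)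
  also have "\<dots> = hurwitz_edist \<Omega> x y + hurwitz_edist \<Omega> y z + (ennreal (e / 2) + ennreal (e / 2))"
    by (simp only: ac_simps)
  also have "ennreal (e / 2) + ennreal (e / 2) = ennreal e"
    using e by (simp flip: ennreal_plus)
  finally show "hurwitz_edist \<Omega> x z \<le> hurwitz_edist \<Omega> x y + hurwitz_edist \<Omega> y z + ennreal e" .
qed

text \<open>The discs of radius \<open>r\<close> about points of the segment lie in \<Omega>, so the
  density along the segment is at most \<open>2 / r\<close>.\<close>

lemma hurwitz_edist_segment_le:
  assumes "open \<Omega>" "a \<notin> \<Omega>" "ball x (2 * r) \<subseteq> \<Omega>" "r > 0" "dist x y \<le> r"
  shows "hurwitz_edist \<Omega> x y \<le> ennreal (2 / r * dist x y)"
proof -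
  have near: "ball w r \<subseteq> \<Omega>" if w: "w \<in> closed_segment x y" for w
  proof -
    have "dist x w \<le> r" using dist_in_closed_segment[OF w, of] assms(5) by (simp add: dist_commute)
    hence "ball w r \<subseteq> ball x (2 * r)" by (metis ball_subset_ball_iff dist_commute add_le_cancel_right mult_2)
    thus ?thesis using assms(3) by blast
  qed
  hence "linepath x y \<in> rectifiable_paths \<Omega> x y"
    using rectifiable_linepath(1) assms(4) by (force simp: rectifiable_paths_def)
  hence "hurwitz_edist \<Omega> x y \<le> arc_integral (hurwitz_density \<Omega>) (linepath x y)"
    unfolding hurwitz_edist_def by (rule INF_lower)
  also have "\<dots> \<le> ennreal (2 / r * variation (linepath x y) 0 1)"
  proof (rule arc_integral_le[OF rectifiable_linepath(1)])
    fix w assume "w \<in> path_image (linepath x y)"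
    hence "r \<le> hurwitz_radius \<Omega> w"
      using hurwitz_radius_ge[OF assms(1,2) near assms(4)] by simp
    thus "hurwitz_density \<Omega> w \<le> 2 / r"
      using assms(4) by (simp add: hurwitz_density_def frac_le)
  qed (use assms(4) in simp)
  also have "\<dots> \<le> ennreal (2 / r * dist x y)"
    using rectifiable_linepath(2)[of x y] assms(4) by (intro ennreal_leI mult_left_mono) auto
  finally show ?thesis .
qed

text \<open>Being at finite distance is symmetric, transitive and true near each point, so the
  classes are open and connectedness leaves only one.\<close>

lemma hurwitz_edist_finite:
  assumes "open \<Omega>" "connected \<Omega>" "a \<notin> \<Omega>" "x \<in> \<Omega>" "y \<in> \<Omega>"
  shows "hurwitz_edist \<Omega> x y < top"
proof (rule connected_equivalence_relation[OF assms(2,4,5)])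
  show "hurwitz_edist \<Omega> v u < top" if "hurwitz_edist \<Omega> u v < top" for u v
    using that hurwitz_edist_commute[OF assms(1,3)] by simp
  show "hurwitz_edist \<Omega> u w < top" if "hurwitz_edist \<Omega> u v < top" "hurwitz_edist \<Omega> v w < top" for u v w
    using le_less_trans[OF hurwitz_edist_triangle[OF assms(1,3), of u w v]] that by simp
  fix u assume "u \<in> \<Omega>"
  then obtain e where e: "e > 0" "ball u e \<subseteq> \<Omega>" using assms(1) open_contains_ball by blast
  have "hurwitz_edist \<Omega> u v < top" if "v \<in> ball u (e / 2)" for v
    using hurwitz_edist_segment_le[OF assms(1,3), of u "e / 2" v] e that
    by (auto intro: le_less_trans)
  moreover have "openin (top_of_set \<Omega>) (ball u (e / 2))"
    using e by (auto intro!: open_subset subset_trans[OF subset_ball e(2)])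
  ultimately show "\<exists>T. openin (top_of_set \<Omega>) T \<and> u \<in> T \<and> (\<forall>v\<in>T. hurwitz_edist \<Omega> u v < top)"
    using e(1) by (intro exI[of _ "ball u (e / 2)"]) auto
qed

text \<open>A path from \<open>x\<close> to \<open>y\<close> covers the length \<open>min (dist x y) (dist x a)\<close> before it leaves
  the disc of radius \<open>dist x a\<close> about \<open>x\<close>, and in this disc the density is bounded below.\<close>

lemma hurwitz_edist_ge:
  "\<exists>C>0. \<forall>\<Omega> a x y. open \<Omega> \<longrightarrow> a \<notin> \<Omega> \<longrightarrow> x \<in> \<Omega> \<longrightarrow>
     ennreal (min (dist x y) (dist x a) / (C * dist x a)) \<le> hurwitz_edist \<Omega> x y"
proof -
  obtain C where C: "C > 0" "\<And>\<Omega> w a. open \<Omega> \<Longrightarrow> w \<in> \<Omega> \<Longrightarrow> a \<notin> \<Omega> \<Longrightarrow> hurwitz_radius \<Omega> w \<le> C * dist w a"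
    using hurwitz_radius_le by meson
  have "ennreal (min (dist x y) (dist x a) / (C * dist x a)) \<le> hurwitz_edist \<Omega> x y"
    if \<Omega>: "open \<Omega>" and a: "a \<notin> \<Omega>" and x: "x \<in> \<Omega>" for \<Omega> a x y
    unfolding hurwitz_edist_def
  proof (rule INF_greatest)
    fix \<gamma> assume "\<gamma> \<in> rectifiable_paths \<Omega> x y"
    hence \<gamma>: "rectifiable_path \<gamma>" "path_image \<gamma> \<subseteq> \<Omega>" "\<gamma> 0 = x" "\<gamma> 1 = y"
      by (auto simp: rectifiable_paths_def pathstart_def pathfinish_def)
    define \<delta> where "\<delta> = dist x a"
    define m where "m = min (dist x y) \<delta>"
    have \<delta>: "\<delta> > 0" using a x by (auto simp: \<delta>_def)
    have cont: "continuous_on {0..1} (\<lambda>t. dist x (\<gamma> t))"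
      by (intro continuous_intros rectifiable_pathD(2) \<gamma>)
    \<comment> \<open>\<open>s\<close> is the first time at which the path has distance
      \<open>m\<close> from \<open>x\<close>; it exists because the endpoint \<open>y\<close> is at
      distance at least \<open>m\<close>.\<close>
    obtain s where s: "0 \<le> s" "s \<le> 1" "dist x (\<gamma> s) = m" "\<And>t. 0 \<le> t \<Longrightarrow> t \<le> s \<Longrightarrow> dist x (\<gamma> t) \<le> m"
    proof -
      define S where "S = {t \<in> {0..1}. m \<le> dist x (\<gamma> t)}"
      have "S = {0..1} \<inter> (\<lambda>t. dist x (\<gamma> t)) -` {m..}" by (auto simp: S_def)
      hence "closed S" using continuous_closed_preimage[OF cont] by simp
      moreover have ne: "S \<noteq> {}" using \<gamma>(4) by (auto simp: S_def m_def intro!: exI[of _ 1])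
      moreover have bdd: "bdd_below S" by (auto simp: S_def intro!: bdd_belowI[of _ 0])
      ultimately have "Inf S \<in> S" by (intro closed_contains_Inf)
      hence s: "0 \<le> Inf S" "Inf S \<le> 1" "m \<le> dist x (\<gamma> (Inf S))" by (auto simp: S_def)
      have lt: "dist x (\<gamma> t) < m" if "0 \<le> t" "t < Inf S" for t
        using cInf_lower[OF _ bdd, of t] that s(2) by (force simp: S_def)
      have "dist x (\<gamma> (Inf S)) \<le> m"
      proof (rule ccontr)
        assume less: "\<not> ?thesis"
        have m0: "0 \<le> m" using \<delta> by (simp add: m_def)
        obtain t where "0 \<le> t" "t \<le> Inf S" "dist x (\<gamma> t) = m"
          using IVT'[of "\<lambda>t. dist x (\<gamma> t)" 0 m "Inf S"] less m0 s \<gamma>(3) continuous_on_subset[OF cont, of "{0..Inf S}"]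
          by auto
        thus False using lt[of t] less by (cases "t = Inf S") auto
      qed
      show thesis
      proof (rule that[OF s(1,2)])
        show "dist x (\<gamma> (Inf S)) = m" using s(3) \<open>dist x (\<gamma> (Inf S)) \<le> m\<close> by simp
        show "dist x (\<gamma> t) \<le> m" if "0 \<le> t" "t \<le> Inf S" for t
          using lt[of t] that \<open>dist x (\<gamma> (Inf S)) \<le> m\<close> by (cases "t = Inf S") auto
      qed
    qed
    \<comment> \<open>Up to time \<open>s\<close> the path stays within \<open>2 * \<delta>\<close>
      of \<open>a\<close>, so the radius is at most \<open>C * (2 * \<delta>)\<close>, and the 2
      cancels against the numerator of the density.\<close>
    have "1 / (C * \<delta>) \<le> hurwitz_density \<Omega> (\<gamma> t)" if t: "0 \<le> t" "t \<le> s" for t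
    proof -
      have in\<Omega>: "\<gamma> t \<in> \<Omega>" using \<gamma>(2) t s(2) by (auto simp: path_image_def)
      have "dist (\<gamma> t) a \<le> dist x (\<gamma> t) + dist x a" by (metis dist_commute dist_triangle)
      also have "\<dots> \<le> 2 * \<delta>" using s(4)[OF t] by (simp add: m_def \<delta>_def)
      finally have "C * dist (\<gamma> t) a \<le> C * (2 * \<delta>)" using C(1) by (intro mult_left_mono) auto
      hence "hurwitz_radius \<Omega> (\<gamma> t) \<le> C * (2 * \<delta>)" using C(2)[OF \<Omega> in\<Omega> a] by linarith
      hence "2 / (C * (2 * \<delta>)) \<le> hurwitz_density \<Omega> (\<gamma> t)"
        unfolding hurwitz_density_def using hurwitz_radius_pos[OF \<Omega> in\<Omega> a] by (intro divide_left_mono) (use C(1) \<delta> in auto)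
      thus ?thesis by simp
    qed
    from arc_integral_ge[where \<rho> = "hurwitz_density \<Omega>", OF \<gamma>(1) s(1,2) _ this]
    show "ennreal (min (dist x y) (dist x a) / (C * dist x a)) \<le> arc_integral (hurwitz_density \<Omega>) \<gamma>"
      using s(3) \<gamma>(3) C(1) \<delta> by (simp add: m_def \<delta>_def)
  qed
  thus ?thesis using C(1) by blast
qed

section \<open>Metric axioms and completeness\<close>

theorem theorem2p3:
  fixes \<Omega> :: "complex set"
  assumes "open \<Omega>" and "connected \<Omega>" and "\<Omega> \<noteq> {}"
    and "\<exists>a b. a \<noteq> b \<and> a \<notin> \<Omega> \<and> b \<notin> \<Omega>"
  shows "Metric_space \<Omega> (hurwitz_dist \<Omega>) \<and> Metric_space.mcomplete \<Omega> (hurwitz_dist \<Omega>)"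
proof -
  let ?d = "hurwitz_dist \<Omega>"
  obtain a where a: "a \<notin> \<Omega>" using assms(4) by blast
  have edist: "ennreal (?d x y) = hurwitz_edist \<Omega> x y" if "x \<in> \<Omega>" "y \<in> \<Omega>" for x y
    using hurwitz_edist_finite[OF assms(1,2) a that] by (simp add: hurwitz_dist_eq)
  have nonneg: "0 \<le> ?d x y" for x y by (simp add: hurwitz_dist_eq)
  obtain C where C: "C > 0" "\<And>a x y. a \<notin> \<Omega> \<Longrightarrow> x \<in> \<Omega> \<Longrightarrow> y \<in> \<Omega> \<Longrightarrow>
     min (dist x y) (dist x a) / (C * dist x a) \<le> ?d x y"
    using hurwitz_edist_ge assms(1) edist nonneg by (metis ennreal_le_iff)
  have d_le: "?d x y \<le> 2 / r * dist x y"
    if "ball x (2 * r) \<subseteq> \<Omega>" "r > 0" "dist x y \<le> r" for x y r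
  proof -
    have "x \<in> \<Omega>" "y \<in> \<Omega>" using that by auto
    thus ?thesis using hurwitz_edist_segment_le[OF assms(1) a that] edist that(2)
      by (metis ennreal_le_iff divide_nonneg_pos mult_nonneg_nonneg zero_le_dist zero_le_numeral)
  qed
  have metric: "Metric_space \<Omega> ?d"
  proof
    show "0 \<le> ?d x y" for x y by (rule nonneg)
    show "?d x y = ?d y x" for x y
      using hurwitz_edist_commute[OF assms(1) a] by (simp add: hurwitz_dist_eq)
    show "?d x y = 0 \<longleftrightarrow> x = y" if xy: "x \<in> \<Omega>" "y \<in> \<Omega>" for x y
    proof
      assume "x = y"
      obtain r where "r > 0" "ball x (2 * r) \<subseteq> \<Omega>"
        using assms(1) xy(1) by (metis open_contains_ball field_sum_of_halves half_gt_zero mult_2)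
      thus "?d x y = 0" using d_le[of x r y] nonneg[of x y] \<open>x = y\<close> by simp
    next
      assume "?d x y = 0"
      \<comment> \<open>Since \<open>dist x a\<close> is positive, the minimum can only fail to be
        positive through \<open>dist x y\<close>.\<close>
      hence *: "min (dist x y) (dist x a) / (C * dist x a) \<le> 0" using C(2)[OF a xy] by simp
      have "dist x a > 0" using xy a by auto
      with * C(1) have "min (dist x y) (dist x a) \<le> 0" by (metis divide_pos_pos mult_pos_pos not_le)
      thus "x = y" using \<open>dist x a > 0\<close> by (auto simp: min_def split: if_splits)
    qed
    show "?d x z \<le> ?d x y + ?d y z" if "x \<in> \<Omega>" "y \<in> \<Omega>" "z \<in> \<Omega>" for x y z
      using hurwitz_edist_triangle[OF assms(1) a, of x z y] nonneg that
      by (simp flip: edist ennreal_plus)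
  qed
  moreover interpret Metric_space \<Omega> ?d by (rule metric)
  have "\<exists>l. limitin mtopology \<sigma> l sequentially" if \<sigma>: "MCauchy \<sigma>" for \<sigma>
  proof -
    have in\<Omega>: "\<sigma> n \<in> \<Omega>" for n using \<sigma> unfolding MCauchy_def by auto
    have cauchy: "\<exists>N. \<forall>m\<ge>N. \<forall>n\<ge>N. ?d (\<sigma> m) (\<sigma> n) < e" if "e > 0" for e
      using \<sigma> that unfolding MCauchy_def by meson
    \<comment> \<open>Below \<open>1 / (2 * C)\<close> the lower bound keeps the minimum under half
      the distance to any omitted point, so the minimum is the Euclidean distance of the two
      terms.\<close>
    obtain N where N: "\<And>m n. m \<ge> N \<Longrightarrow> n \<ge> N \<Longrightarrow> ?d (\<sigma> m) (\<sigma> n) < 1 / (2 * C)"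
      using cauchy[of "1 / (2 * C)"] C(1) by auto
    have close: "dist (\<sigma> m) (\<sigma> n) \<le> C * dist (\<sigma> m) b * ?d (\<sigma> m) (\<sigma> n)"
      if "m \<ge> N" "n \<ge> N" "b \<notin> \<Omega>" for m n b
    proof -
      have pos: "dist (\<sigma> m) b > 0" using in\<Omega> that by auto
      have *: "min (dist (\<sigma> m) (\<sigma> n)) (dist (\<sigma> m) b) \<le> C * dist (\<sigma> m) b * ?d (\<sigma> m) (\<sigma> n)"
        using C(2)[OF that(3) in\<Omega> in\<Omega>, of m n] C(1) pos by (simp add: divide_le_eq mult_ac)
      also have "\<dots> < C * dist (\<sigma> m) b * (1 / (2 * C))"
        using N that C(1) pos by (intro mult_strict_left_mono) auto
      also have "\<dots> < dist (\<sigma> m) b" using C(1) pos by simp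
      finally show ?thesis using * by (simp add: min_def split: if_splits)
    qed
    define x where "x = \<sigma> N"
    \<comment> \<open>A nearest point of the closed complement: \<open>dist x b\<close> is at once
      the distance to an omitted point and the radius of a disc inside \<Omega>.\<close>
    obtain b where b: "b \<notin> \<Omega>" "infdist x (- \<Omega>) = dist x b"
      using infdist_attains_inf[of "- \<Omega>" x] assms(1) a by auto
    define \<delta> where "\<delta> = dist x b"
    have \<delta>: "\<delta> > 0" using b in\<Omega> by (auto simp: \<delta>_def x_def)
    have ball: "ball x \<delta> \<subseteq> \<Omega>"
      using infdist_le[of _ "- \<Omega>" x] b(2) by (force simp: \<delta>_def)
    have near: "dist x (\<sigma> n) \<le> \<delta> / 2" if "n \<ge> N" for n
    proof -
      have "dist x (\<sigma> n) \<le> C * \<delta> * ?d (\<sigma> N) (\<sigma> n)"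
        using close[OF order_refl that b(1)] by (simp add: x_def \<delta>_def)
      also have "\<dots> \<le> C * \<delta> * (1 / (2 * C))"
        using N[OF order_refl that] C(1) \<delta> by (intro mult_left_mono) auto
      finally show ?thesis using C(1) by simp
    qed
    have "Cauchy \<sigma>"
      unfolding Cauchy_def
    proof (intro allI impI)
      fix e :: real assume e: "e > 0"
      \<comment> \<open>\<open>2 * C * \<delta>\<close> bounds the factor in \<open>close\<close>,
        because \<open>dist (\<sigma> m) b \<le> 2 * \<delta>\<close> for late terms.\<close>
      obtain M where M: "\<And>m n. m \<ge> M \<Longrightarrow> n \<ge> M \<Longrightarrow> ?d (\<sigma> m) (\<sigma> n) < e / (2 * C * \<delta>)"
        using cauchy[of "e / (2 * C * \<delta>)"] C(1) \<delta> e by auto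
      have "dist (\<sigma> m) (\<sigma> n) < e" if mn: "m \<ge> max M N" "n \<ge> max M N" for m n
      proof -
        have "dist (\<sigma> m) b \<le> 2 * \<delta>"
          using near[of m] mn dist_triangle[of "\<sigma> m" b x] zero_le_dist[of x b]
          unfolding \<delta>_def dist_commute[of x "\<sigma> m"] by (simp del: zero_le_dist)
        hence "C * dist (\<sigma> m) b * ?d (\<sigma> m) (\<sigma> n) \<le> C * (2 * \<delta>) * ?d (\<sigma> m) (\<sigma> n)"
          using C(1) nonneg by (intro mult_right_mono mult_left_mono) auto
        also have "\<dots> < C * (2 * \<delta>) * (e / (2 * C * \<delta>))"
          using M mn C(1) \<delta> by (intro mult_strict_left_mono) auto
        also have "\<dots> = e" using C(1) \<delta> by simp
        finally show ?thesis using close[of m n b] mn b(1) by simp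
      qed
      thus "\<exists>M. \<forall>m\<ge>M. \<forall>n\<ge>M. dist (\<sigma> m) (\<sigma> n) < e" by blast
    qed
    then obtain l where l: "\<sigma> \<longlonglongrightarrow> l" using Cauchy_convergent_iff convergent_def by blast
    \<comment> \<open>The limit stays in the closed disc of half the radius, so a disc of radius
      \<open>\<delta> / 2\<close> about it lies in \<Omega>; writing this radius as
      \<open>2 * (\<delta> / 4)\<close> prepares \<open>d_le\<close> with
      \<open>r = \<delta> / 4\<close>.\<close>
    have "l \<in> cball x (\<delta> / 2)"
      by (rule closed_sequentially[of _ "\<lambda>n. \<sigma> (n + N)"]) (use near l in \<open>auto simp: LIMSEQ_ignore_initial_segment\<close>)
    hence "ball l (2 * (\<delta> / 4)) \<subseteq> ball x \<delta>"
      by (simp add: ball_subset_ball_iff dist_commute)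
    hence bl: "ball l (2 * (\<delta> / 4)) \<subseteq> \<Omega>" using ball by blast
    hence l\<Omega>: "l \<in> \<Omega>" using \<delta> by auto
    have "\<exists>M. \<forall>n\<ge>M. \<sigma> n \<in> \<Omega> \<and> ?d (\<sigma> n) l < e" if e: "e > 0" for e
    proof -
      \<comment> \<open>The first bound is the range of validity of \<open>d_le\<close>, the second
        offsets its factor \<open>2 / (\<delta> / 4)\<close>.\<close>
      have "min (\<delta> / 4) (e * \<delta> / 8) > 0" using e \<delta> by simp
      then obtain M where M: "\<And>n. n \<ge> M \<Longrightarrow> dist (\<sigma> n) l < min (\<delta> / 4) (e * \<delta> / 8)"
        using l unfolding LIMSEQ_def by blast
      have "?d (\<sigma> n) l < e" if n: "n \<ge> M" for n
      proof -
        have "?d (\<sigma> n) l = ?d l (\<sigma> n)" by (rule commute)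
        also have "\<dots> \<le> 2 / (\<delta> / 4) * dist l (\<sigma> n)"
          using M[OF n] \<delta> by (intro d_le[OF bl]) (auto simp: dist_commute)
        also have "\<dots> < 2 / (\<delta> / 4) * (e * \<delta> / 8)"
          using M[OF n] \<delta> e by (intro mult_strict_left_mono) (auto simp: dist_commute)
        also have "\<dots> = e" using \<delta> by simp
        finally show ?thesis .
      qed
      thus ?thesis using in\<Omega> by blast
    qed
    thus ?thesis using l\<Omega> limit_metric_sequentially by blast
  qed
  hence "mcomplete" unfolding mcomplete_def by blast
  ultimately show ?thesis by blast
qed

end
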